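(* Let $\phi$ be an analytic self-map of the upper half-plane $\mathbb{H}$ of parabolic type, i.e. such that $\phi(z)\to\infty$ and $\phi(z)/z\to1$ as $z\to\infty$ non-tangentially. Let $\{w_n=x_n+iy_n\}_{n=0}^{\infty}\subset\mathbb{H}$ be a backward-iteration sequence for $\phi$, i.e. $\phi(w_{n+1})=w_n$ for $n=0,1,2,\dots$, with bounded pseudo-hyperbolic steps $d_n=d(w_n,w_{n+1})\uparrow a<1$, which tends to infinity and such that $\operatorname{Arg} w_n$ tends to $0$. Let $\tau_n(z)=x_n+y_nz$, let $\psi=\lim_{n\to\infty}\phi_n\circ\tau_n$, let $b_0=\frac{2a}{\sqrt{1-a^2}}$, and let $\zeta_n=i+nb_0$. Then: (1) $\psi(\zeta_n)=w_n$ for all $n$, and $\psi'(\zeta_n)/y_n\to1$ as $n\to\infty$. (2) $\psi$ has non-tangential limit $\infty$ at $\infty$. (3) $\lim_{n\to\infty}\phi'(w_n)=1$.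
   Context: $\mathbb{H}=\{z\in\mathbb{C}:\operatorname{Im} z>0\}$, and $d(z,w)=\left|\frac{w-z}{w-\overline{z}}\right|$ is the pseudo-hyperbolic distance on $\mathbb{H}$. Non-tangential limits at $\infty$ are limits as $z\to\infty$ within each sector $\{|\operatorname{Arg} z-\pi/2|<\theta_0\}$, $\theta_0\in(0,\pi/2)$. $\phi_n$ denotes the $n$-th iterate of $\phi$; $d_n\uparrow a$ means that $d_n$ is non-decreasing with limit $a$. It is known (another theorem of the paper) that under the stated hypotheses $\phi_n\circ\tau_n$ converges uniformly on compact subsets of $\mathbb{H}$ to an analytic self-map $\psi$ of $\mathbb{H}$ with $\psi(z-b_0)=\phi\circ\psi(z)$, where $b_0=\frac{2a}{\sqrt{1-a^2}}=\lim_n\frac{x_{n+1}-x_n}{y_n}$; this is the map $\psi$ of the claim. *)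

theory Defs
  imports "HOL-Complex_Analysis.Complex_Analysis"
begin

definition upper_half_plane :: "complex set" where
  "upper_half_plane = {z. Im z > 0}"

definition pseudo_hyp_dist :: "complex \<Rightarrow> complex \<Rightarrow> real" where
  "pseudo_hyp_dist z w = cmod ((w - z) / (w - cnj z))"

(* For 0 < \<theta> < pi/2 the library convention Arg 0 = 0 excludes the origin,
   so this is a subset of the upper half-plane. *)
definition nt_sector :: "real \<Rightarrow> complex set" where
  "nt_sector \<theta> = {z. \<bar>Arg z - pi / 2\<bar> < \<theta>}"

(* Non-tangential limit at infinity along a target filter F: take F = nhds l for a
   finite limit l and F = at_infinity for the limit infinity. *)
definition nt_limit_at_infinity :: "(complex \<Rightarrow> complex) \<Rightarrow> complex filter \<Rightarrow> bool" where
  "nt_limit_at_infinity f F \<longleftrightarrow>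
     (\<forall>\<theta>\<in>{0<..<pi / 2}. filterlim f F (inf at_infinity (principal (nt_sector \<theta>))))"

definition parabolic_self_map :: "(complex \<Rightarrow> complex) \<Rightarrow> bool" where
  "parabolic_self_map \<phi> \<longleftrightarrow>
     \<phi> holomorphic_on upper_half_plane \<and>
     \<phi> ` upper_half_plane \<subseteq> upper_half_plane \<and>
     nt_limit_at_infinity \<phi> at_infinity \<and>
     nt_limit_at_infinity (\<lambda>z. \<phi> z / z) (nhds 1)"

definition backward_iteration_seq :: "(complex \<Rightarrow> complex) \<Rightarrow> (nat \<Rightarrow> complex) \<Rightarrow> bool" where
  "backward_iteration_seq \<phi> w \<longleftrightarrow>
     (\<forall>n. w n \<in> upper_half_plane) \<and> (\<forall>n. \<phi> (w (Suc n)) = w n)"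

end

(* The rescaled maps between consecutive orbit points fix i and almost preserve the hyperbolic
   distance to a second point, hence are almost rotations about i; Julia's lemma Im \<phi> \<ge> Im excludes
   all rotations except the identity. Consequently the normalised steps vary slowly. Their heights must
   tend to 1, since otherwise \<phi> would look like an expanding affine map on a large half-disc and the
   backward orbit would converge to a finite point; so the steps converge to i + b0. A self-map of the
   half-plane that fixes i and moves i + b0 only slightly is close to the identity: applied to
   \<tau>_m^{-1} \<phi>_{n-m} \<tau>_n this gives the convergence of \<phi>_n \<tau>_n, and applied to \<tau>_n^{-1} \<psi>(z + n b0)
   it gives the derivative asymptotics of \<psi>. *)

theory Submission
  imports Defs
begin

section \<open>Schwarz--Pick inequalities in the half-plane\<close>

text \<open>Explicit bounds take the place of normal families. A map \<open>g\<close> fixing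
  \<open>\<i>\<close> is measured by the Schwarz quotient of \<open>cay \<circ> g\<close> by
  \<open>cay\<close>, a map into the closed unit disc: once its value at one other point is close to
  a unimodular number, Harnack's inequality keeps it close to that number on compact sets. Such
  control reaches only compact parts of the half-plane at the scale of one orbit point, while an
  orbit with dropping heights sinks towards the real axis. The missing range is supplied by a
  harmonic barrier: \<open>Im (\<phi> z) - Im z\<close> is harmonic and non-negative, so a lower
  bound on an arc propagates down to the axis. Convergence has to be proved although
  \<open>\<psi>\<close> is given as a \<open>lim\<close>, since \<open>lim\<close> of a divergent
  sequence is an unspecified value.\<close>

abbreviation (input) "uhp \<equiv> upper_half_plane"
abbreviation (input) "pd \<equiv> pseudo_hyp_dist"

lemma uhp_iff [simp]: "z \<in> uhp \<longleftrightarrow> Im z > 0"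
  by (simp add: upper_half_plane_def)

lemma open_uhp: "open uhp"
  unfolding upper_half_plane_def by (rule open_halfspace_Im_gt)

lemma diff_cnj_nz: "Im z > 0 \<Longrightarrow> Im w > 0 \<Longrightarrow> w - cnj z \<noteq> 0"
  by (auto simp: complex_eq_iff)

lemma pd_nonneg [simp]: "0 \<le> pd z w"
  by (simp add: pseudo_hyp_dist_def)

lemma pd_commute: "pd z w = pd w z"
proof -
  have "cmod (w - cnj z) = cmod (z - cnj w)"
    by (metis complex_cnj_cnj complex_cnj_diff complex_mod_cnj norm_minus_commute)
  then show ?thesis
    by (simp add: pseudo_hyp_dist_def norm_divide norm_minus_commute)
qed

text \<open>Through this identity Schwarz-Pick becomes an inequality between heights. It serves
  Julia's lemma, the comparison with Euclidean boxes and the limit of \<open>\<psi>\<close> at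
  infinity.\<close>

lemma one_minus_pd_sq:
  assumes "Im z > 0" "Im w > 0"
  shows "1 - (pd z w)\<^sup>2 = 4 * Im z * Im w / (cmod (w - cnj z))\<^sup>2"
proof -
  have "(cmod (w - cnj z))\<^sup>2 - (cmod (w - z))\<^sup>2 = 4 * Im z * Im w"
    unfolding cmod_power2 by (simp add: power2_eq_square algebra_simps)
  moreover have "cmod (w - cnj z) \<noteq> 0"
    using diff_cnj_nz[OF assms] by simp
  then have "1 - (pd z w)\<^sup>2 = ((cmod (w - cnj z))\<^sup>2 - (cmod (w - z))\<^sup>2) / (cmod (w - cnj z))\<^sup>2"
    unfolding pseudo_hyp_dist_def norm_divide power_divide by (simp add: diff_divide_distrib)
  ultimately show ?thesis
    by simp
qed

lemma tendsto_pd: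
  assumes "(f \<longlongrightarrow> l) F" "(g \<longlongrightarrow> m) F" "Im l > 0" "Im m > 0"
  shows "((\<lambda>n. pd (f n) (g n)) \<longlongrightarrow> pd l m) F"
  unfolding pseudo_hyp_dist_def using assms diff_cnj_nz by (intro tendsto_intros) auto

lemma pd_eq_0_iff: "Im z > 0 \<Longrightarrow> Im w > 0 \<Longrightarrow> pd z w = 0 \<longleftrightarrow> z = w"
  using diff_cnj_nz by (auto simp: pseudo_hyp_dist_def)

lemma pd_self [simp]: "pd z z = 0"
  by (simp add: pseudo_hyp_dist_def)

lemma pd_less_1:
  assumes "Im z > 0" "Im w > 0"
  shows "pd z w < 1"
proof -
  have "4 * Im z * Im w / (cmod (w - cnj z))\<^sup>2 > 0"
    using assms diff_cnj_nz[OF assms] by simp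
  then have "(pd z w)\<^sup>2 < 1\<^sup>2"
    using one_minus_pd_sq[OF assms] by simp
  then show ?thesis
    by (rule power_less_imp_less_base) simp
qed

lemma norm_diff_le_pd:
  assumes "Im z > 0" "Im w > 0"
  shows "cmod (w - z) = pd z w * cmod (w - cnj z)"
  using diff_cnj_nz[OF assms] by (simp add: pseudo_hyp_dist_def norm_divide)

theorem schwarz_pick_uhp:
  assumes holf: "f holomorphic_on uhp" and f: "\<And>z. Im z > 0 \<Longrightarrow> Im (f z) > 0"
    and c: "Im c > 0" and z: "Im z > 0"
  shows "pd (f c) (f z) \<le> pd c z"
proof -
  \<comment> \<open>\<open>C\<close> is the Moebius map of the unit disc onto the half-plane with
    \<open>C 0 = c\<close>; \<open>F\<close> is \<open>f\<close> read in discs centred at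
    \<open>c\<close> and \<open>f c\<close>, so that the Schwarz lemma at 0 applies.\<close>
  define C where "C = (\<lambda>\<zeta>. (c - cnj c * \<zeta>) / (1 - \<zeta>))"
  define F where "F = (\<lambda>\<zeta>. (f (C \<zeta>) - f c) / (f (C \<zeta>) - cnj (f c)))"
  have nz: "1 - \<zeta> \<noteq> 0" if "cmod \<zeta> < 1" for \<zeta>
    using that by auto
  have ImC: "Im (C \<zeta>) > 0" if "cmod \<zeta> < 1" for \<zeta>
  proof -
    have "C \<zeta> = (c - cnj c * \<zeta>) * cnj (1 - \<zeta>) / of_real ((cmod (1 - \<zeta>))\<^sup>2)"
      unfolding C_def by (subst complex_div_cnj) simp
    then have "Im (C \<zeta>) = Im ((c - cnj c * \<zeta>) * cnj (1 - \<zeta>)) / (cmod (1 - \<zeta>))\<^sup>2"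
      by (simp only: Im_divide_of_real)
    also have "Im ((c - cnj c * \<zeta>) * cnj (1 - \<zeta>)) = Im c * (1 - (cmod \<zeta>)\<^sup>2)"
      unfolding cmod_power2 by (simp add: power2_eq_square algebra_simps)
    finally show ?thesis
      using nz[OF that] c that by (simp add: power_less_one_iff abs_square_less_1)
  qed
  have fnz: "f (C \<zeta>) - cnj (f c) \<noteq> 0" if "cmod \<zeta> < 1" for \<zeta>
    using diff_cnj_nz f ImC c that by blast
  have holF: "F holomorphic_on ball 0 1"
  proof -
    have "C holomorphic_on ball 0 1"
      unfolding C_def by (intro holomorphic_intros) auto
    moreover have "C ` ball 0 1 \<subseteq> uhp"
      using ImC by auto
    ultimately have "(f \<circ> C) holomorphic_on ball 0 1"
      using holf by (intro holomorphic_on_compose_gen[of C _ f uhp])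
    then have "(\<lambda>\<zeta>. f (C \<zeta>)) holomorphic_on ball 0 1"
      by (simp add: o_def)
    then show ?thesis
      unfolding F_def using fnz by (intro holomorphic_intros) auto
  qed
  have F0: "F 0 = 0"
    by (simp add: F_def C_def)
  have normF: "cmod (F \<zeta>) = pd (f c) (f (C \<zeta>))" for \<zeta>
    by (simp add: F_def pseudo_hyp_dist_def)
  define \<xi> where "\<xi> = (z - c) / (z - cnj c)"
  have \<xi>: "cmod \<xi> = pd c z"
    by (simp add: \<xi>_def pseudo_hyp_dist_def)
  have zc: "z - cnj c \<noteq> 0" "c - cnj c \<noteq> 0"
    using diff_cnj_nz c z by blast+
  have "1 - \<xi> = (c - cnj c) / (z - cnj c)"
    using zc by (simp add: \<xi>_def field_simps)
  moreover have "c - cnj c * \<xi> = z * (c - cnj c) / (z - cnj c)"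
    using zc by (simp add: \<xi>_def field_simps)
  ultimately have "C \<xi> = z"
    using zc by (simp add: C_def)
  moreover have "cmod (F \<xi>) \<le> cmod \<xi>"
    using Schwarz_Lemma(1)[OF holF F0, of \<xi>] normF pd_less_1 f ImC c z \<xi> by metis
  ultimately show ?thesis
    using normF \<xi> by simp
qed

text \<open>The function \<^term>\<open>\<lambda>z. 1 - cnj u * h z\<close> has non-negative real part, so this is a form of
  Harnack's inequality.\<close>

lemma holomorphic_norm_le_1_near_unimodular:
  assumes holh: "h holomorphic_on uhp" and h: "\<And>z. Im z > 0 \<Longrightarrow> cmod (h z) \<le> 1"
    and u: "cmod u = 1" and c: "Im c > 0" and z: "Im z > 0"
  shows "cmod (h z - u) \<le> (1 + pd c z) / (1 - pd c z) * cmod (h c - u)"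
proof -
  define r where "r = pd c z"
  have r: "0 \<le> r" "r < 1"
    using pd_less_1[OF c z] by (auto simp: r_def)
  have bound: "cmod (h z - u) \<le> (1 + r) / (1 - r) * (cmod (h c - u) + e) + e" if e: "e > 0" for e :: real
  proof -
    \<comment> \<open>The shift by \<open>e\<close> pushes the image into the open half-plane, as
      Schwarz-Pick requires: \<open>1 - cnj u * h\<close> may have vanishing real part, for instance
      when \<open>h\<close> is the constant \<open>u\<close>. At the end \<open>e\<close> tends to
      0.\<close>
    define k where "k = (\<lambda>z. \<i> * (1 - cnj u * h z) + \<i> * of_real e)"
    have "k holomorphic_on uhp"
      unfolding k_def by (intro holomorphic_intros holh)
    moreover have Imk: "Im (k v) > 0" if "Im v > 0" for v
    proof -
      have "Re (cnj u * h v) \<le> cmod (cnj u * h v)"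
        by (rule complex_Re_le_cmod)
      also have "\<dots> \<le> 1"
        using h[OF that] u by (simp add: norm_mult)
      finally show ?thesis
        using e by (simp add: k_def)
    qed
    ultimately have "pd (k c) (k z) \<le> r"
      unfolding r_def using c z by (intro schwarz_pick_uhp) auto
    then have "cmod (k z - k c) \<le> r * cmod (k z - cnj (k c))"
      using norm_diff_le_pd[OF Imk[OF c] Imk[OF z]] by (simp add: mult_right_mono)
    also have "\<dots> \<le> r * (cmod (k z) + cmod (k c))"
      using r by (intro mult_left_mono) (metis complex_mod_cnj norm_triangle_ineq4)
    finally have "cmod (k z) \<le> cmod (k c) + r * (cmod (k z) + cmod (k c))"
      using norm_triangle_ineq2[of "k z" "k c"] by linarith
    then have "cmod (k z) * (1 - r) \<le> (1 + r) * cmod (k c)"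
      by (simp add: algebra_simps)
    then have "cmod (k z) \<le> (1 + r) / (1 - r) * cmod (k c)"
      using r by (simp add: field_simps)
    moreover have uk: "k v = - \<i> * cnj u * (h v - u) + \<i> * of_real e" for v
      using complex_norm_square[of u] u
      by (simp add: k_def algebra_simps)
    have "cmod (- \<i> * cnj u * (h v - u)) = cmod (h v - u)" for v
      using u by (simp add: norm_mult)
    then have "cmod (h z - u) \<le> cmod (k z) + e" "cmod (k c) \<le> cmod (h c - u) + e"
      using uk[of z] uk[of c] e norm_triangle_ineq4[of "k z" "\<i> * of_real e"]
        norm_triangle_ineq[of "- \<i> * cnj u * (h c - u)" "\<i> * of_real e"]
      by (simp_all add: norm_mult u)
    moreover have "(1 + r) / (1 - r) * cmod (k c) \<le> (1 + r) / (1 - r) * (cmod (h c - u) + e)"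
      using calculation r by (intro mult_left_mono) auto
    ultimately show ?thesis
      by linarith
  qed
  have "((\<lambda>e. (1 + r) / (1 - r) * (cmod (h c - u) + e) + e) \<longlongrightarrow> (1 + r) / (1 - r) * (cmod (h c - u) + 0) + 0)
      (at_right 0)"
    by (intro tendsto_intros)
  then have "cmod (h z - u) \<le> (1 + r) / (1 - r) * (cmod (h c - u) + 0) + 0"
    by (rule tendsto_lowerbound) (use bound in \<open>auto intro!: eventually_at_rightI[of 0 1]\<close>)
  then show ?thesis
    by (simp add: r_def)
qed

section \<open>Self-maps fixing \<open>\<i>\<close>, in the Cayley coordinate\<close>

definition cay :: "complex \<Rightarrow> complex" where
  "cay z = (z - \<i>) / (z + \<i>)"

lemma plus_i_nz: "Im z > 0 \<Longrightarrow> z + \<i> \<noteq> 0"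
  by (auto simp: complex_eq_iff)

lemma norm_cay: "cmod (cay z) = pd \<i> z"
  by (simp add: cay_def pseudo_hyp_dist_def)

lemma cay_diff:
  assumes "Im z > 0" "Im w > 0"
  shows "cay z - cay w = 2 * \<i> * (z - w) / ((z + \<i>) * (w + \<i>))"
  using plus_i_nz[OF assms(1)] plus_i_nz[OF assms(2)]
  by (simp add: cay_def divide_simps) (simp add: algebra_simps)

lemma cay_eq_0_iff: "Im z > 0 \<Longrightarrow> cay z = 0 \<longleftrightarrow> z = \<i>"
  using plus_i_nz by (simp add: cay_def)

lemma tendsto_cay:
  assumes "(f \<longlongrightarrow> l) F" "Im l > 0"
  shows "((\<lambda>n. cay (f n)) \<longlongrightarrow> cay l) F"
  unfolding cay_def using assms plus_i_nz by (intro tendsto_intros) auto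

text \<open>The singularity of the Schwarz quotient at \<open>\<i>\<close> is removable because
  \<open>cay\<close> has a simple zero there; Schwarz-Pick bounds the quotient elsewhere, and
  continuity carries the bound to \<open>\<i>\<close>.\<close>

lemma fixpoint_factor:
  assumes holg: "g holomorphic_on uhp" and g: "\<And>z. Im z > 0 \<Longrightarrow> Im (g z) > 0" and gi: "g \<i> = \<i>"
  obtains h where "h holomorphic_on uhp" "\<And>z. Im z > 0 \<Longrightarrow> cmod (h z) \<le> 1"
    "\<And>z. Im z > 0 \<Longrightarrow> cay (g z) = h z * cay z" "h \<i> = deriv g \<i>"
proof -
  define q where "q = (\<lambda>z. if z = \<i> then deriv g \<i> else (g z - g \<i>) / (z - \<i>))"
  define h where "h = (\<lambda>z. q z * (z + \<i>) / (g z + \<i>))"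
  have "\<i> \<in> interior uhp"
    using interior_open[OF open_uhp] by simp
  then have "q holomorphic_on uhp"
    unfolding q_def by (rule pole_lemma[OF holg])
  then have holh: "h holomorphic_on uhp"
    unfolding h_def using plus_i_nz g by (intro holomorphic_intros holg) auto
  have eq: "cay (g z) = h z * cay z" if "Im z > 0" for z
    using that plus_i_nz[OF that] plus_i_nz[OF g[OF that]] gi
    by (cases "z = \<i>") (auto simp: h_def q_def cay_def)
  have le: "cmod (h z) \<le> 1" if z: "Im z > 0" "z \<noteq> \<i>" for z
  proof -
    have "pd (g \<i>) (g z) \<le> pd \<i> z"
      using z by (intro schwarz_pick_uhp holg g) auto
    then have "cmod (cay (g z)) \<le> cmod (cay z)"
      by (simp add: norm_cay gi)
    then have "cmod (h z) * cmod (cay z) \<le> 1 * cmod (cay z)"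
      using eq[OF z(1)] by (simp add: norm_mult)
    moreover have "cmod (cay z) > 0"
      using z by (simp add: cay_eq_0_iff)
    ultimately show ?thesis
      by (rule mult_right_le_imp_le)
  qed
  have "isCont h \<i>"
    using holomorphic_on_imp_continuous_on[OF holh] continuous_on_eq_continuous_at[OF open_uhp, of h] by auto
  then have "((\<lambda>z. cmod (h z)) \<longlongrightarrow> cmod (h \<i>)) (at \<i>)"
    by (intro tendsto_norm) (simp add: isCont_def)
  moreover have "eventually (\<lambda>z. z \<in> uhp) (at \<i>)"
    by (rule eventually_at_in_open') (auto simp: open_uhp)
  then have "eventually (\<lambda>z. cmod (h z) \<le> 1) (at \<i>)"
    using eventually_neq_at_within[of \<i> \<i> UNIV] by eventually_elim (auto intro: le)
  ultimately have "cmod (h \<i>) \<le> 1"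
    by (rule tendsto_upperbound) simp
  then have "cmod (h z) \<le> 1" if "Im z > 0" for z
    using le that by (cases "z = \<i>") auto
  moreover have "h \<i> = deriv g \<i>"
    by (simp add: h_def q_def gi field_simps)
  ultimately show thesis
    using that holh eq by blast
qed

text \<open>Hyperbolic closeness gives Euclidean control at the scale of \<open>Im u\<close>. The
  first bound rests on \<open>Im u \<le> cmod (v - cnj u)\<close>, the second on
  \<open>v - cnj u = (v - u) + 2 * Im u * \<i>\<close>.\<close>

lemma pd_le_imp:
  assumes u: "Im u > 0" and v: "Im v > 0" and k: "pd u v \<le> k" "k < 1"
  shows "(1 - k\<^sup>2) / 4 * Im u \<le> Im v" and "cmod (v - u) \<le> 2 * k / (1 - k) * Im u"
proof -
  have "1 - k\<^sup>2 \<le> 1 - (pd u v)\<^sup>2"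
    using k(1) by (simp add: power_mono)
  also have "\<dots> = 4 * Im u * Im v / (cmod (v - cnj u))\<^sup>2"
    using u v by (rule one_minus_pd_sq)
  also have "\<dots> \<le> 4 * Im u * Im v / (Im u)\<^sup>2"
  proof -
    have "\<bar>Im (v - cnj u)\<bar> \<le> cmod (v - cnj u)"
      by (rule abs_Im_le_cmod)
    then have "Im u \<le> cmod (v - cnj u)"
      using u v by simp
    then have "(Im u)\<^sup>2 \<le> (cmod (v - cnj u))\<^sup>2"
      using u by (intro power_mono) auto
    then show ?thesis
      using u v \<open>Im u \<le> cmod (v - cnj u)\<close> by (intro divide_left_mono mult_pos_pos) auto
  qed
  also have "\<dots> = 4 * Im v / Im u"
    using u by (simp add: power2_eq_square)
  finally show "(1 - k\<^sup>2) / 4 * Im u \<le> Im v"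
    using u by (simp add: field_simps)
  have k0: "0 \<le> k"
    using k(1) pd_nonneg order_trans by blast
  have "v - cnj u = (v - u) + of_real (2 * Im u) * \<i>"
    by (simp add: complex_eq_iff)
  then have "cmod (v - cnj u) \<le> cmod (v - u) + cmod (of_real (2 * Im u) * \<i>)"
    by (metis norm_triangle_ineq)
  then have "cmod (v - cnj u) \<le> cmod (v - u) + 2 * Im u"
    using u by (simp add: norm_mult)
  then have "cmod (v - u) \<le> k * (cmod (v - u) + 2 * Im u)"
    using norm_diff_le_pd[OF u v] k k0 by (metis mult_mono norm_ge_zero)
  then show "cmod (v - u) \<le> 2 * k / (1 - k) * Im u"
    using k(2) by (simp add: field_simps)
qed

text \<open>The denominator \<open>cmod (v - cnj u)\<close> is at most \<open>2 * R\<close>. This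
  square root is the \<open>k < 1\<close> that recurs below as a bound for the hyperbolic diameter
  of a box.\<close>

lemma pd_le_of_bounds:
  assumes "cmod u \<le> R" "cmod v \<le> R" "m \<le> Im u" "m \<le> Im v" "0 < m"
  shows "pd u v \<le> sqrt (1 - m\<^sup>2 / R\<^sup>2)"
proof -
  have uv: "Im u > 0" "Im v > 0"
    using assms by auto
  have "cmod (v - cnj u) \<le> 2 * R"
    using norm_triangle_ineq4[of v "cnj u"] assms by simp
  then have "(cmod (v - cnj u))\<^sup>2 \<le> (2 * R)\<^sup>2"
    by (intro power_mono) auto
  moreover have "m\<^sup>2 \<le> Im u * Im v"
    using assms by (simp add: power2_eq_square mult_mono)
  moreover have "cmod (v - cnj u) > 0"
    using diff_cnj_nz[OF uv] by simp
  ultimately have "4 * m\<^sup>2 / (2 * R)\<^sup>2 \<le> 4 * Im u * Im v / (cmod (v - cnj u))\<^sup>2"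
    using uv by (intro frac_le) auto
  also have "\<dots> = 1 - (pd u v)\<^sup>2"
    using uv by (simp add: one_minus_pd_sq)
  finally have "(pd u v)\<^sup>2 \<le> 1 - m\<^sup>2 / R\<^sup>2"
    by (simp add: power2_eq_square)
  then show ?thesis
    by (rule real_le_rsqrt)
qed

text \<open>In the disc the distance is
  \<open>cmod (cay u - cay v) / cmod (1 - cnj (cay v) * cay u)\<close>, with denominator at least
  \<open>1 - cmod (cay v)\<close>.\<close>

lemma pd_le_cay_diff:
  assumes u: "Im u > 0" and v: "Im v > 0"
  shows "pd u v \<le> cmod (cay u - cay v) / (1 - pd \<i> v)"
proof -
  have 1: "1 - cnj (cay v) * cay u = 2 * \<i> * (cnj v - u) / ((cnj v - \<i>) * (u + \<i>))"
  proof -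
    have "cnj v - \<i> \<noteq> 0"
      using plus_i_nz[OF v] by (metis complex_cnj_add complex_cnj_cnj complex_cnj_i complex_cnj_zero_iff uminus_add_conv_diff add.commute)
    then show ?thesis
      using plus_i_nz[OF u] by (simp add: cay_def divide_simps) (simp add: algebra_simps)
  qed
  have 2: "cmod (cnj v - \<i>) = cmod (v + \<i>)"
    by (metis complex_cnj_add complex_cnj_i complex_mod_cnj uminus_add_conv_diff add.commute)
  have 3: "cmod (cnj v - u) = cmod (v - cnj u)"
    by (metis complex_cnj_cnj complex_cnj_diff complex_mod_cnj)
  have 4: "pd u v = cmod (u - v) / cmod (v - cnj u)"
    by (simp add: pseudo_hyp_dist_def norm_divide norm_minus_commute)
  have "cmod (cay u - cay v) = pd u v * cmod (1 - cnj (cay v) * cay u)"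
    unfolding 1 cay_diff[OF u v] norm_mult norm_divide 2 3 4
    using plus_i_nz[OF u] plus_i_nz[OF v] diff_cnj_nz[OF u v] by (simp add: divide_simps)
  moreover have "1 - pd \<i> v \<le> cmod (1 - cnj (cay v) * cay u)"
  proof -
    have "cmod (cnj (cay v) * cay u) \<le> pd \<i> v * 1"
      unfolding norm_mult complex_mod_cnj norm_cay
      using pd_less_1[of \<i> u] u by (intro mult_left_mono) auto
    then show ?thesis
      using norm_triangle_ineq2[of 1 "cnj (cay v) * cay u"] by simp
  qed
  ultimately have "pd u v * (1 - pd \<i> v) \<le> cmod (cay u - cay v)"
    by (simp add: mult_left_mono)
  then show ?thesis
    using pd_less_1[of \<i> v] v by (simp add: field_simps)
qed

text \<open>Harnack's inequality with \<open>u = 1\<close> for the quotient \<open>h\<close> of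
  \<open>fixpoint_factor\<close>, whose value is \<open>cay (g c) / cay c\<close> at
  \<open>c\<close> and \<open>deriv g \<i>\<close> at \<open>\<i>\<close>.\<close>

lemma near_identity:
  assumes holg: "g holomorphic_on uhp" and g: "\<And>z. Im z > 0 \<Longrightarrow> Im (g z) > 0" and gi: "g \<i> = \<i>"
    and c: "Im c > 0" "c \<noteq> \<i>"
  shows "Im z > 0 \<Longrightarrow> pd (g z) z \<le> (1 + pd c z) / (1 - pd c z) * cmod (cay (g c) / cay c - 1) / (1 - pd \<i> z)"
    and "cmod (deriv g \<i> - 1) \<le> (1 + pd c \<i>) / (1 - pd c \<i>) * cmod (cay (g c) / cay c - 1)"
proof -
  obtain h where h: "h holomorphic_on uhp" "\<And>z. Im z > 0 \<Longrightarrow> cmod (h z) \<le> 1"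
    "\<And>z. Im z > 0 \<Longrightarrow> cay (g z) = h z * cay z" "h \<i> = deriv g \<i>"
    using fixpoint_factor[OF holg g gi] by blast
  have hc: "h c = cay (g c) / cay c"
    using h(3)[OF c(1)] c cay_eq_0_iff by simp
  have near: "cmod (h z - 1) \<le> (1 + pd c z) / (1 - pd c z) * cmod (cay (g c) / cay c - 1)" if "Im z > 0" for z
    using holomorphic_norm_le_1_near_unimodular[OF h(1,2) _ c(1) that, of 1] by (simp add: hc)
  from near[of \<i>] show "cmod (deriv g \<i> - 1) \<le> (1 + pd c \<i>) / (1 - pd c \<i>) * cmod (cay (g c) / cay c - 1)"
    by (simp add: h(4))
  assume z: "Im z > 0"
  have "cay (g z) - cay z = (h z - 1) * cay z"
    using h(3)[OF z] by (simp add: algebra_simps)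
  then have "cmod (cay (g z) - cay z) \<le> cmod (h z - 1)"
    using pd_less_1[of \<i> z] z by (simp add: norm_mult norm_cay mult_left_le)
  also note near[OF z]
  finally have "cmod (cay (g z) - cay z) / (1 - pd \<i> z) \<le>
      (1 + pd c z) / (1 - pd c z) * cmod (cay (g c) / cay c - 1) / (1 - pd \<i> z)"
    using pd_less_1[of \<i> z] z by (intro divide_right_mono) auto
  then show "pd (g z) z \<le> (1 + pd c z) / (1 - pd c z) * cmod (cay (g c) / cay c - 1) / (1 - pd \<i> z)"
    using pd_le_cay_diff[OF g[OF z] z] by linarith
qed

section \<open>Height inequalities: Julia's lemma and a harmonic barrier\<close>

text \<open>Schwarz-Pick for \<open>z\<close> and \<open>\<i> * t\<close>, rewritten with
  \<open>one_minus_pd_sq\<close> and multiplied by \<open>t\<close>, has a finite limit as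
  \<open>t\<close> grows because \<open>f (\<i> * t) / (\<i> * t)\<close> tends to 1; the limit
  compares the two heights.\<close>

lemma julia_uhp:
  assumes holf: "f holomorphic_on uhp" and f: "\<And>z. Im z > 0 \<Longrightarrow> Im (f z) > 0"
    and lim: "((\<lambda>t. f (\<i> * of_real t) / (\<i> * of_real t)) \<longlongrightarrow> 1) at_top"
    and z: "Im z > 0"
  shows "Im z \<le> Im (f z)"
proof -
  define A where "A = (\<lambda>t. f (\<i> * of_real t) / (\<i> * of_real t))"
  have small: "((\<lambda>t. c / (\<i> * of_real t)) \<longlongrightarrow> 0) at_top" for c
    by (intro tendsto_divide_0[OF tendsto_const] tendsto_mult_filterlim_at_infinity[OF tendsto_const]
        filterlim_of_real_at_infinity) auto
  have le: "Im z / (cmod (1 - cnj z / (\<i> * of_real t)))\<^sup>2 \<le>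
      Im (f z) * Re (A t) / (cmod (A t - cnj (f z) / (\<i> * of_real t)))\<^sup>2" if t: "t > 0" for t
  proof -
    define v where "v = \<i> * complex_of_real t"
    have v: "Im v > 0" "cmod v = t" "v \<noteq> 0"
      using t by (auto simp: v_def norm_mult)
    have "pd (f z) (f v) \<le> pd z v"
      by (intro schwarz_pick_uhp holf f z v)
    then have "1 - (pd z v)\<^sup>2 \<le> 1 - (pd (f z) (f v))\<^sup>2"
      by (simp add: power_mono)
    then have "Im z * Im v / (cmod (v - cnj z))\<^sup>2 \<le> Im (f z) * Im (f v) / (cmod (f v - cnj (f z)))\<^sup>2"
      using z v f by (simp add: one_minus_pd_sq)
    then have "Im z * (t * t) / (cmod (v - cnj z))\<^sup>2 \<le> Im (f z) * Im (f v) * t / (cmod (f v - cnj (f z)))\<^sup>2"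
      using mult_right_mono[of _ _ t] t by (fastforce simp: v_def)
    moreover have "1 - cnj z / v = (v - cnj z) / v" "A t - cnj (f z) / v = (f v - cnj (f z)) / v"
      using v by (simp_all add: A_def v_def field_simps)
    moreover have "Re (A t) = Im (f v) / t"
      using t by (simp add: A_def v_def Re_divide power2_eq_square)
    ultimately show ?thesis
      unfolding v_def[symmetric] using t v by (simp add: norm_divide power_divide power2_eq_square mult_ac)
  qed
  have "((\<lambda>t. Im z / (cmod (1 - cnj z / (\<i> * of_real t)))\<^sup>2) \<longlongrightarrow> Im z / (cmod (1 - 0))\<^sup>2) at_top"
    by (intro tendsto_intros small) auto
  moreover have "((\<lambda>t. Im (f z) * Re (A t) / (cmod (A t - cnj (f z) / (\<i> * of_real t)))\<^sup>2) \<longlongrightarrow>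
      Im (f z) * Re 1 / (cmod (1 - 0))\<^sup>2) at_top"
    using lim unfolding A_def[symmetric] by (intro tendsto_intros small) auto
  moreover have "eventually (\<lambda>t. Im z / (cmod (1 - cnj z / (\<i> * of_real t)))\<^sup>2 \<le>
      Im (f z) * Re (A t) / (cmod (A t - cnj (f z) / (\<i> * of_real t)))\<^sup>2) at_top"
    using eventually_gt_at_top[of 0] by eventually_elim (rule le)
  ultimately have "Im z / (cmod (1 - 0))\<^sup>2 \<le> Im (f z) * Re 1 / (cmod (1 - 0))\<^sup>2"
    by (intro tendsto_le[of at_top]) auto
  then show ?thesis
    by simp
qed

lemma parabolic_self_mapD:
  assumes "parabolic_self_map \<phi>"
  shows "\<phi> holomorphic_on uhp" and "Im z > 0 \<Longrightarrow> Im (\<phi> z) > 0" and "Im z > 0 \<Longrightarrow> Im z \<le> Im (\<phi> z)"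
proof -
  show hol: "\<phi> holomorphic_on uhp" and pos: "Im z > 0 \<Longrightarrow> Im (\<phi> z) > 0" for z
    using assms by (auto simp: parabolic_self_map_def image_subset_iff)
  \<comment> \<open>Any aperture would do: the ray \<open>\<i> * t\<close> is the axis of every
    sector.\<close>
  have "filterlim (\<lambda>z. \<phi> z / z) (nhds 1) (inf at_infinity (principal (nt_sector (pi / 4))))"
    using assms by (auto simp: parabolic_self_map_def nt_limit_at_infinity_def)
  moreover have "filterlim (\<lambda>t. \<i> * complex_of_real t) (inf at_infinity (principal (nt_sector (pi / 4)))) at_top"
    unfolding filterlim_inf filterlim_principal
  proof
    show "filterlim (\<lambda>t. \<i> * complex_of_real t) at_infinity at_top"
      by (intro tendsto_mult_filterlim_at_infinity[OF tendsto_const] filterlim_of_real_at_infinity) auto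
    have "\<i> * complex_of_real t \<in> nt_sector (pi / 4)" if "t > 0" for t
    proof -
      have "Arg (\<i> * complex_of_real t) = pi / 2"
        using Arg_times_of_real2[OF that, of \<i>] by simp
      then show ?thesis
        by (simp only: nt_sector_def mem_Collect_eq) simp
    qed
    then show "eventually (\<lambda>t. \<i> * complex_of_real t \<in> nt_sector (pi / 4)) at_top"
      by (rule eventually_mono[OF eventually_gt_at_top])
  qed
  ultimately have "((\<lambda>t. \<phi> (\<i> * of_real t) / (\<i> * of_real t)) \<longlongrightarrow> 1) at_top"
    by (rule filterlim_compose)
  then show "Im z > 0 \<Longrightarrow> Im z \<le> Im (\<phi> z)"
    by (intro julia_uhp hol pos)
qed

text \<open>The barrier is the imaginary part of $\frac23(z - z^3/(2R^2))$, which vanishes on the real axis,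
  is at most $\operatorname{Im} z$ on the circle $|z| = R$, and is negative there where
  $\operatorname{Im} z < R/2$.\<close>

lemma Im_lower_bound_half_disc:
  assumes holf: "f holomorphic_on uhp" and f: "\<And>z. Im z > 0 \<Longrightarrow> 0 \<le> Im (f z)"
    and R: "R > 0" and arc: "\<And>z. cmod z = R \<Longrightarrow> R / 2 \<le> Im z \<Longrightarrow> Im z \<le> Im (f z)"
    and z: "Im z > 0" "cmod z \<le> R / 2"
  shows "5 / 12 * Im z \<le> Im (f z)"
proof -
  define b where "b = (\<lambda>z. 2 / 3 * (z - z ^ 3 / (2 * of_real R ^ 2)) :: complex)"
  have Imb: "Im (b z) = 2 / 3 * Im z * (1 - (3 * (cmod z)\<^sup>2 - 4 * (Im z)\<^sup>2) / (2 * R\<^sup>2))" for z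
  proof -
    have "Im (z ^ 3) = Im z * (3 * (cmod z)\<^sup>2 - 4 * (Im z)\<^sup>2)"
      unfolding cmod_power2 by (simp add: power3_eq_cube power2_eq_square algebra_simps)
    moreover have "Im (z ^ 3 / (2 * of_real R ^ 2)) = Im (z ^ 3) / (2 * R\<^sup>2)"
      by (metis Im_divide_of_real of_real_mult of_real_numeral of_real_power)
    ultimately show ?thesis
      using R by (simp add: b_def field_simps)
  qed
  have main: "Im (b z) - Im (f z) \<le> s" if s: "0 < s" "s < Im z" "s < R" for s
  proof -
    \<comment> \<open>The disc is cut at height \<open>s\<close> because nothing is known about
      \<open>f\<close> on the real axis. On the cut \<open>Im b \<le> s\<close>, which produces the
      error \<open>s\<close>; it disappears as \<open>s\<close> tends to 0.\<close>
    define S where "S = cball 0 R \<inter> {z. s \<le> Im z}"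
    have clS: "closed S"
      unfolding S_def by (intro closed_Int closed_cball closed_halfspace_Im_ge)
    have S: "S \<subseteq> uhp"
      using s by (auto simp: S_def)
    have hol: "(\<lambda>z. \<i> * (f z - b z)) holomorphic_on S"
      unfolding b_def using R by (intro holomorphic_intros holomorphic_on_subset[OF holf S]) auto
    have "Re (\<i> * (f z - b z)) \<le> s"
    proof (rule maximum_real_frontier[where S = S and f = "\<lambda>z. \<i> * (f z - b z)"])
      show "(\<lambda>z. \<i> * (f z - b z)) holomorphic_on interior S"
        using hol interior_subset by (rule holomorphic_on_subset)
      show "continuous_on (closure S) (\<lambda>z. \<i> * (f z - b z))"
        using hol clS by (simp add: holomorphic_on_imp_continuous_on)
      show "bounded S"
        unfolding S_def by (intro bounded_Int) auto
      show "z \<in> S"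
        using s z R by (simp add: S_def)
      fix v assume "v \<in> frontier S"
      then have vS: "v \<in> S" and vi: "v \<notin> interior S"
        using clS by (auto simp: frontier_def)
      then have v: "cmod v \<le> R" "s \<le> Im v" "Im v > 0"
        using s by (auto simp: S_def)
      have "ball 0 R \<inter> {z. s < Im z} \<subseteq> interior S"
        by (intro interior_maximal open_Int open_ball open_halfspace_Im_gt) (auto simp: S_def)
      then have "\<not> (cmod v < R \<and> s < Im v)"
        using vi by auto
      then consider "cmod v = R" "Im v < R / 2" | "cmod v = R" "R / 2 \<le> Im v" | "Im v = s"
        using v by linarith
      then have "Im (b v) \<le> s + Im (f v)"
      proof cases
        case 1
        then have "4 * (Im v)\<^sup>2 \<le> R\<^sup>2"
          using v power_mono[of "2 * Im v" R 2] by (simp add: power2_eq_square)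
        then have "1 - (3 * (cmod v)\<^sup>2 - 4 * (Im v)\<^sup>2) / (2 * R\<^sup>2) \<le> 0"
          using R 1 by (simp add: field_simps)
        then have "Im (b v) \<le> 0"
          unfolding Imb using v by (intro mult_nonneg_nonpos) auto
        then show ?thesis
          using f[OF v(3)] s by linarith
      next
        case 2
        have "(Im v)\<^sup>2 \<le> (cmod v)\<^sup>2"
          by (simp add: cmod_power2)
        then have "1 - (3 * (cmod v)\<^sup>2 - 4 * (Im v)\<^sup>2) / (2 * R\<^sup>2) \<le> 3 / 2"
          using R 2 by (simp add: field_simps)
        then have "Im (b v) \<le> 2 / 3 * Im v * (3 / 2)"
          unfolding Imb using v by (intro mult_left_mono) auto
        then show ?thesis
          using arc[OF 2] s by simp
      next
        case 3
        have "(Im v)\<^sup>2 \<le> (cmod v)\<^sup>2"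
          by (simp add: cmod_power2)
        moreover have "(Im v)\<^sup>2 \<le> R\<^sup>2"
          using v s 3 by (intro power_mono) auto
        ultimately have "1 - (3 * (cmod v)\<^sup>2 - 4 * (Im v)\<^sup>2) / (2 * R\<^sup>2) \<le> 3 / 2"
          using R by (simp add: field_simps)
        then have "Im (b v) \<le> 2 / 3 * Im v * (3 / 2)"
          unfolding Imb using v by (intro mult_left_mono) auto
        then show ?thesis
          using 3 f[OF v(3)] by simp
      qed
      then show "Re (\<i> * (f v - b v)) \<le> s"
        by simp
    qed
    then show ?thesis
      by simp
  qed
  have "Im (b z) - Im (f z) \<le> 0"
  proof (rule field_le_epsilon)
    fix e :: real assume "e > 0"
    then obtain s where "0 < s" "s < Im z" "s < R" "s \<le> e"
      using z R by (metis dense min_less_iff_conj less_imp_le)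
    then show "Im (b z) - Im (f z) \<le> 0 + e"
      using main[of s] by linarith
  qed
  \<comment> \<open>In the inner half-disc the bracket in \<open>Imb\<close> is at least
    \<open>1 - 3 / 8 = 5 / 8\<close>, and \<open>2 / 3 * (5 / 8) = 5 / 12\<close>.\<close>
  moreover have "5 / 12 * Im z \<le> Im (b z)"
  proof -
    have four: "(2::real)\<^sup>2 = 4"
      by simp
    have "(2 * cmod z)\<^sup>2 \<le> R\<^sup>2"
      using z by (intro power_mono) auto
    then have "0 \<le> 3 * R\<^sup>2 + (16 * (Im z)\<^sup>2 - 12 * (cmod z)\<^sup>2)"
      using zero_le_power2[of "Im z"] unfolding power_mult_distrib four by linarith
    then have "5 / 8 \<le> 1 - (3 * (cmod z)\<^sup>2 - 4 * (Im z)\<^sup>2) / (2 * R\<^sup>2)"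
      using R by (simp add: divide_simps)
    then have "2 / 3 * Im z * (5 / 8) \<le> Im (b z)"
      unfolding Imb using z by (intro mult_left_mono) auto
    then show ?thesis
      by simp
  qed
  ultimately show ?thesis
    by linarith
qed

text \<open>The threshold \<open>\<eta>\<close> depends only on the box and
  \<open>\<epsilon>\<close>. The conditions \<open>\<mu> \<le> 1 \<le> R\<close> put
  \<open>\<i>\<close> itself in the box, so one diameter bound covers all pairs among
  \<open>\<i>\<close>, \<open>c\<close> and \<open>z\<close>.\<close>

lemma near_identity_uniform:
  assumes "0 < \<mu>" "\<mu> \<le> 1" "1 \<le> R" "0 < \<epsilon>"
  obtains \<eta> where "\<eta> > 0"
    "\<And>g c z. g holomorphic_on uhp \<Longrightarrow> (\<And>z. Im z > 0 \<Longrightarrow> Im (g z) > 0) \<Longrightarrow> g \<i> = \<i> \<Longrightarrow>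
      c \<noteq> \<i> \<Longrightarrow> \<mu> \<le> Im c \<Longrightarrow> cmod c \<le> R \<Longrightarrow> cmod (cay (g c) / cay c - 1) \<le> \<eta> \<Longrightarrow>
      \<mu> \<le> Im z \<Longrightarrow> cmod z \<le> R \<Longrightarrow> pd (g z) z \<le> \<epsilon>"
    "\<And>g c. g holomorphic_on uhp \<Longrightarrow> (\<And>z. Im z > 0 \<Longrightarrow> Im (g z) > 0) \<Longrightarrow> g \<i> = \<i> \<Longrightarrow>
      c \<noteq> \<i> \<Longrightarrow> \<mu> \<le> Im c \<Longrightarrow> cmod c \<le> R \<Longrightarrow> cmod (cay (g c) / cay c - 1) \<le> \<eta> \<Longrightarrow>
      cmod (deriv g \<i> - 1) \<le> \<epsilon>"
proof -
  define k where "k = sqrt (1 - \<mu>\<^sup>2 / R\<^sup>2)"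
  have k: "0 \<le> k" "k < 1"
  proof -
    have "\<mu>\<^sup>2 \<le> R\<^sup>2"
      using assms by (intro power_mono) auto
    then show "0 \<le> k" "k < 1"
      using assms by (auto simp: k_def)
  qed
  \<comment> \<open>Harnack's factor is at most \<open>2 / (1 - k)\<close>; returning from
    \<open>cay\<close> to \<open>pd\<close> costs another \<open>1 / (1 - k)\<close>.\<close>
  define \<eta> where "\<eta> = \<epsilon> * (1 - k)\<^sup>2 / 2"
  have \<eta>: "\<eta> > 0"
    using assms k by (simp add: \<eta>_def)
  have box: "pd u v \<le> k" if "\<mu> \<le> Im u" "\<mu> \<le> Im v" "cmod u \<le> R" "cmod v \<le> R" for u v
    unfolding k_def using that assms by (intro pd_le_of_bounds) auto
  have factor: "(1 + r) / (1 - r) \<le> 2 / (1 - k)" if "0 \<le> r" "r \<le> k" for r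
    using that k by (intro frac_le) auto
  show thesis
  proof (rule that[of \<eta>])
    fix g :: "complex \<Rightarrow> complex" and c z
    assume g: "g holomorphic_on uhp" "\<And>z. Im z > 0 \<Longrightarrow> Im (g z) > 0" "g \<i> = \<i>"
      and c: "c \<noteq> \<i>" "\<mu> \<le> Im c" "cmod c \<le> R" "cmod (cay (g c) / cay c - 1) \<le> \<eta>"
      and z: "\<mu> \<le> Im z" "cmod z \<le> R"
    have pos: "Im c > 0" "Im z > 0"
      using assms c z by auto
    have "pd (g z) z \<le> (1 + pd c z) / (1 - pd c z) * cmod (cay (g c) / cay c - 1) / (1 - pd \<i> z)"
      using near_identity(1)[OF g pos(1) c(1) pos(2)] .
    also have "\<dots> \<le> 2 / (1 - k) * \<eta> / (1 - k)"
      using box[of c z] box[of \<i> z] c z assms k \<eta> factor[of "pd c z"]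
      by (intro frac_le mult_mono) auto
    also have "\<dots> = \<epsilon>"
      using k by (simp add: \<eta>_def power2_eq_square)
    finally show "pd (g z) z \<le> \<epsilon>" .
  next
    fix g :: "complex \<Rightarrow> complex" and c
    assume g: "g holomorphic_on uhp" "\<And>z. Im z > 0 \<Longrightarrow> Im (g z) > 0" "g \<i> = \<i>"
      and c: "c \<noteq> \<i>" "\<mu> \<le> Im c" "cmod c \<le> R" "cmod (cay (g c) / cay c - 1) \<le> \<eta>"
    have pos: "Im c > 0"
      using assms c by auto
    have "cmod (deriv g \<i> - 1) \<le> (1 + pd c \<i>) / (1 - pd c \<i>) * cmod (cay (g c) / cay c - 1)"
      using near_identity(2)[OF g pos c(1)] .
    also have "\<dots> \<le> 2 / (1 - k) * \<eta>"
      using box[of c \<i>] c assms k \<eta> factor[of "pd c \<i>"] by (intro mult_mono) auto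
    also have "\<dots> = \<epsilon> * (1 - k)"
      using k by (simp add: \<eta>_def power2_eq_square)
    also have "\<dots> \<le> \<epsilon>"
      using assms k by (simp add: algebra_simps)
    finally show "cmod (deriv g \<i> - 1) \<le> \<epsilon>" .
  qed (fact \<eta>)
qed

lemma pd_affine:
  assumes "t > 0"
  shows "pd (of_real s + of_real t * u) (of_real s + of_real t * v) = pd u v"
proof -
  have "(of_real s + of_real t * v) - (of_real s + of_real t * u) = of_real t * (v - u)"
    "(of_real s + of_real t * v) - cnj (of_real s + of_real t * u) = of_real t * (v - cnj u)"
    by (simp_all add: algebra_simps)
  then show ?thesis
    using assms by (simp add: pseudo_hyp_dist_def)
qed

lemma holomorphic_funpow_uhp:
  assumes "f holomorphic_on uhp" "\<And>z. Im z > 0 \<Longrightarrow> Im (f z) > 0"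
  shows "(f ^^ n) holomorphic_on uhp \<and> (\<forall>z. Im z > 0 \<longrightarrow> Im ((f ^^ n) z) > 0)"
proof (induction n)
  case 0
  then show ?case
    by (simp add: holomorphic_on_id)
next
  case (Suc n)
  then have "(f \<circ> f ^^ n) holomorphic_on uhp"
    using assms(1) by (intro holomorphic_on_compose_gen[of _ _ f uhp]) auto
  then show ?case
    using Suc assms(2) by (simp add: o_def)
qed

section \<open>Rescaled backward orbits\<close>

locale backward_orbit =
  fixes \<phi> :: "complex \<Rightarrow> complex" and w :: "nat \<Rightarrow> complex" and a :: real
  assumes parabolic: "parabolic_self_map \<phi>"
    and backward: "backward_iteration_seq \<phi> w"
    and steps_mono: "incseq (\<lambda>n. pd (w n) (w (Suc n)))"
    and steps_lim: "(\<lambda>n. pd (w n) (w (Suc n))) \<longlonglongrightarrow> a"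
    and a_less: "a < 1"
    and w_infinity: "filterlim w at_infinity sequentially"
    and w_Arg: "(\<lambda>n. Arg (w n)) \<longlonglongrightarrow> 0"
begin

abbreviation x :: "nat \<Rightarrow> real" where "x n \<equiv> Re (w n)"
abbreviation y :: "nat \<Rightarrow> real" where "y n \<equiv> Im (w n)"

definition T :: "nat \<Rightarrow> complex \<Rightarrow> complex" where
  "T n z = of_real (x n) + of_real (y n) * z"

definition S :: "nat \<Rightarrow> complex \<Rightarrow> complex" where
  "S n z = (z - of_real (x n)) / of_real (y n)"

text \<open>The normalised step: the next orbit point in the affine coordinate that puts
  \<open>w n\<close> at \<open>\<i>\<close>. The whole proof turns on the convergence of this
  sequence.\<close>

definition e :: "nat \<Rightarrow> complex" where
  "e n = S n (w (Suc n))"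

text \<open>For \<open>m \<le> n\<close> the iterate takes \<open>w n\<close> to \<open>w m\<close>
  and \<open>w (Suc n)\<close> to \<open>w (Suc m)\<close>. Rescaling at both ends therefore yields
  a self-map with fixed point \<open>\<i>\<close> that sends \<open>e n\<close> to
  \<open>e m\<close>.\<close>

definition G :: "nat \<Rightarrow> nat \<Rightarrow> complex \<Rightarrow> complex" where
  "G m n z = S m ((\<phi> ^^ (n - m)) (T n z))"

lemmas phi_hol = parabolic_self_mapD(1)[OF parabolic]
  and phi_pos = parabolic_self_mapD(2)[OF parabolic]
  and Im_phi_ge = parabolic_self_mapD(3)[OF parabolic]

lemmas funpow_hol = holomorphic_funpow_uhp[OF phi_hol phi_pos, THEN conjunct1]
  and funpow_pos = holomorphic_funpow_uhp[OF phi_hol phi_pos, THEN conjunct2, rule_format]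

lemma y_pos [simp]: "y n > 0"
  using backward by (auto simp: backward_iteration_seq_def)

lemma y_nz [simp]: "y n \<noteq> 0"
  by (metis y_pos less_irrefl)

lemma phi_w: "\<phi> (w (Suc n)) = w n"
  using backward by (auto simp: backward_iteration_seq_def)

lemma funpow_w: "(\<phi> ^^ n) (w (n + k)) = w k"
  by (induction n) (simp_all del: funpow.simps(2) add: funpow_Suc_right phi_w)

lemma y_Suc_le: "y (Suc n) \<le> y n"
  using Im_phi_ge[of "w (Suc n)"] by (simp add: phi_w)

lemma y_antimono: "m \<le> n \<Longrightarrow> y n \<le> y m"
  by (rule lift_Suc_antimono_le[of y]) (auto intro: y_Suc_le)

lemma Im_T [simp]: "Im (T n z) = y n * Im z"
  by (simp add: T_def)

lemma Im_S [simp]: "Im (S n z) = Im z / y n"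
  by (simp add: S_def)

lemma Re_S [simp]: "Re (S n z) = (Re z - x n) / y n"
  by (simp add: S_def)

lemma T_S [simp]: "T n (S n z) = z"
  by (simp add: T_def S_def)

lemma S_T [simp]: "S n (T n z) = z"
  by (simp add: T_def S_def)

lemma T_i [simp]: "T n \<i> = w n"
  by (simp add: T_def complex_eq_iff)

lemma S_w [simp]: "S n (w n) = \<i>"
  using S_T[of n \<i>] by simp

lemma T_hol: "T n holomorphic_on A"
  unfolding T_def by (intro holomorphic_intros)

lemma S_hol: "S n holomorphic_on A"
  unfolding S_def by (intro holomorphic_intros) auto

lemma pd_T [simp]: "pd (T n u) (T n v) = pd u v"
  unfolding T_def by (simp add: pd_affine)

lemma pd_S [simp]: "pd (S n u) (S n v) = pd u v"
  by (metis T_S pd_T)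

lemma pd_e: "pd \<i> (e n) = pd (w n) (w (Suc n))"
  by (metis S_w e_def pd_S)

lemma pd_e_lim: "(\<lambda>n. pd \<i> (e n)) \<longlonglongrightarrow> a"
  using steps_lim by (simp add: pd_e)

lemma pd_e_le: "pd \<i> (e n) \<le> a"
  using incseq_le[OF steps_mono steps_lim] by (simp add: pd_e)

lemma Im_e: "Im (e n) = y (Suc n) / y n"
  by (simp add: e_def)

lemma Re_e: "Re (e n) = (x (Suc n) - x n) / y n"
  by (simp add: e_def)

lemma Im_e_pos [simp]: "Im (e n) > 0"
  by (simp add: Im_e)

lemma Im_e_le: "Im (e n) \<le> 1"
  using y_Suc_le by (simp add: Im_e)

text \<open>Otherwise every step would vanish and the orbit, being constant, could not tend to
  infinity.\<close>

lemma a_pos: "a > 0"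
proof (rule ccontr)
  assume "\<not> a > 0"
  have "w (Suc n) = w n" for n
  proof -
    have "pd (w n) (w (Suc n)) = 0"
      using pd_e_le[of n] \<open>\<not> a > 0\<close> by (intro antisym[OF _ pd_nonneg]) (simp add: pd_e)
    then show ?thesis
      using diff_cnj_nz[of "w n" "w (Suc n)"] by (auto simp: pseudo_hyp_dist_def)
  qed
  then have "w n = w 0"
    for n by (induction n) auto
  then have "w = (\<lambda>n. w 0)"
    by blast
  then have "filterlim (\<lambda>n::nat. w 0) at_infinity sequentially"
    using w_infinity by metis
  then show False
    using not_tendsto_and_filterlim_at_infinity[OF _ tendsto_const] by (metis sequentially_bot)
qed

section \<open>Uniform bounds on the normalised steps\<close>

text \<open>These are the constants of \<open>pd_le_imp\<close> with \<open>u = \<i>\<close> and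
  \<open>k = a\<close>; they confine all \<open>e n\<close> to one box.\<close>

definition \<mu> :: real where "\<mu> = (1 - a\<^sup>2) / 4"
definition B :: real where "B = 2 * a / (1 - a)"

lemma mu: "0 < \<mu>" "\<mu> \<le> 1"
proof -
  have "a\<^sup>2 < 1"
    using a_pos a_less by (simp add: abs_square_less_1)
  then show "0 < \<mu>"
    by (simp add: \<mu>_def)
  have "- a\<^sup>2 \<le> 3"
    by (rule order_trans[of _ 0]) simp_all
  then show "\<mu> \<le> 1"
    by (simp add: \<mu>_def)
qed

lemma B_pos: "0 < B"
  using a_pos a_less by (simp add: B_def)

lemma mu_le_Im_e: "\<mu> \<le> Im (e n)"
  using pd_le_imp(1)[of \<i> "e n" a] pd_e_le a_less by (simp add: \<mu>_def)

lemma e_minus_i_le: "cmod (e n - \<i>) \<le> B"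
  using pd_le_imp(2)[of \<i> "e n" a] pd_e_le a_less by (simp add: B_def)

lemma norm_e_le: "cmod (e n) \<le> 1 + B"
  using norm_triangle_ineq[of "e n - \<i>" \<i>] e_minus_i_le[of n] by simp

lemma w_step_le: "cmod (w (Suc n) - w n) \<le> B * y n"
proof -
  have "w (Suc n) - w n = of_real (y n) * (e n - \<i>)"
    by (simp add: e_def S_def field_simps complex_eq_iff)
  then have "cmod (w (Suc n) - w n) = y n * cmod (e n - \<i>)"
    by (simp add: norm_mult abs_of_pos)
  then show ?thesis
    using e_minus_i_le[of n] y_pos[of n] by (simp add: mult.commute mult_left_mono)
qed

lemma G_pos: "Im z > 0 \<Longrightarrow> Im (G m n z) > 0"
  using funpow_pos[of "T n z"] by (simp add: G_def)

lemma G_hol: "G m n holomorphic_on uhp"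
proof -
  have "(S m \<circ> (\<phi> ^^ (n - m) \<circ> T n)) holomorphic_on uhp"
    using funpow_hol by (intro holomorphic_on_compose S_hol holomorphic_on_compose_gen[of "T n" _ _ uhp] T_hol) auto
  then show ?thesis
    by (simp add: G_def[abs_def] o_def)
qed

lemma G_i: "m \<le> n \<Longrightarrow> G m n \<i> = \<i>"
  using funpow_w[of "n - m" m] by (simp add: G_def)

lemma G_e: "m \<le> n \<Longrightarrow> G m n (e n) = e m"
  using funpow_w[of "n - m" "Suc m"] by (simp add: G_def e_def)

lemma phi_T: "\<phi> (T (Suc n) z) = T n (G n (Suc n) z)"
  by (simp add: G_def)

lemma pd_e_pos: "eventually (\<lambda>n. pd \<i> (e n) > 0) sequentially"
  using pd_e_lim a_pos by (rule order_tendstoD(1))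

lemma e_ne_i: "eventually (\<lambda>n. e n \<noteq> \<i>) sequentially"
  using pd_e_pos by eventually_elim (auto simp: pseudo_hyp_dist_def)

section \<open>Slow variation of the steps\<close>

lemma cay_e_quotient_norm: "(\<lambda>n. cmod (cay (e n) / cay (e (Suc n)))) \<longlonglongrightarrow> 1"
proof -
  have "(\<lambda>n. pd \<i> (e n) / pd \<i> (e (Suc n))) \<longlonglongrightarrow> a / a"
    using a_pos by (intro tendsto_divide pd_e_lim LIMSEQ_Suc) auto
  then show ?thesis
    using a_pos by (simp add: norm_divide norm_cay)
qed

text \<open>Since the modulus tends to 1, the quotient of \<^term>\<open>cay \<circ> G n (Suc n)\<close> by \<^term>\<open>cay\<close> is
  nearly a unimodular constant, and Julia's lemma high up on the imaginary axis shows that this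
  constant is nearly 1: the only rotations about \<^term>\<open>\<i>\<close> fixing infinity are trivial.\<close>

lemma cay_e_quotient: "(\<lambda>n. cay (e n) / cay (e (Suc n))) \<longlonglongrightarrow> 1"
proof (rule tendstoI)
  fix \<epsilon> :: real assume \<epsilon>: "\<epsilon> > 0"
  \<comment> \<open>The second entry makes the final error \<open>8 / (\<mu> * t)\<close> at most
    \<open>\<epsilon> / 2\<close>; the 3 ensures
    \<open>cmod (cay (\<i> * t)) = (t - 1) / (t + 1) \<ge> 1 / 2\<close>.\<close>
  define t where "t = max 3 (16 / (\<mu> * \<epsilon>))"
  have t: "t \<ge> 3" "16 / (\<mu> * \<epsilon>) \<le> t"
    by (auto simp: t_def)
  have tsmall: "8 / (\<mu> * t) \<le> \<epsilon> / 2"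
    using t mu \<epsilon> by (simp add: field_simps)
  define R where "R = 1 + B + t"
  define k where "k = sqrt (1 - \<mu>\<^sup>2 / R\<^sup>2)"
  have "\<mu>\<^sup>2 \<le> R\<^sup>2"
    using mu B_pos t by (intro power_mono) (auto simp: R_def)
  then have k: "0 \<le> k" "k < 1"
    using mu B_pos t by (auto simp: k_def R_def)
  define K where "K = 1 + 2 / (1 - k)"
  have K: "K > 0"
    using k by (simp add: K_def add_pos_pos)
  have "(\<lambda>n. K * \<bar>cmod (cay (e n) / cay (e (Suc n))) - 1\<bar>) \<longlonglongrightarrow> K * \<bar>1 - 1\<bar>"
    by (intro tendsto_intros cay_e_quotient_norm)
  then have "eventually (\<lambda>n. K * \<bar>cmod (cay (e n) / cay (e (Suc n))) - 1\<bar> < \<epsilon> / 2) sequentially"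
    using \<epsilon> by (intro order_tendstoD(2)[of _ 0]) auto
  moreover have "eventually (\<lambda>n. cmod (cay (e n) / cay (e (Suc n))) > 0) sequentially"
    using cay_e_quotient_norm by (rule order_tendstoD(1)) simp
  ultimately show "eventually (\<lambda>n. dist (cay (e n) / cay (e (Suc n))) 1 < \<epsilon>) sequentially"
  proof eventually_elim
    case (elim n)
    define q where "q = cay (e n) / cay (e (Suc n))"
    have q0: "q \<noteq> 0" and qK: "K * \<bar>cmod q - 1\<bar> < \<epsilon> / 2"
      using elim by (auto simp: q_def)
    obtain h where h: "h holomorphic_on uhp" "\<And>z. Im z > 0 \<Longrightarrow> cmod (h z) \<le> 1"
      "\<And>z. Im z > 0 \<Longrightarrow> cay (G n (Suc n) z) = h z * cay z"
      using fixpoint_factor[OF G_hol G_pos G_i] by (metis Suc_n_not_le_n nat_le_linear)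
    have hq: "h (e (Suc n)) = q"
      using h(3)[of "e (Suc n)"] q0 by (auto simp: q_def G_e)
    \<comment> \<open>The unimodular number nearest to \<open>q\<close>, at distance equal to the
      defect of the modulus, which tends to 0.\<close>
    define u where "u = sgn q"
    have u: "cmod u = 1" "cmod (q - u) = \<bar>cmod q - 1\<bar>"
    proof -
      show "cmod u = 1"
        using q0 by (simp add: u_def norm_sgn)
      have "q - u = of_real (cmod q - 1) * u"
        using q0 by (simp add: u_def sgn_div_norm scaleR_conv_of_real field_simps)
      then show "cmod (q - u) = \<bar>cmod q - 1\<bar>"
        using \<open>cmod u = 1\<close> by (simp only: norm_mult norm_of_real) simp
    qed
    define v where "v = \<i> * complex_of_real t"
    have v: "Im v = t" "cmod v = t"
      using t by (auto simp: v_def norm_mult)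
    have "pd (e (Suc n)) v \<le> k"
      unfolding k_def using norm_e_le[of "Suc n"] mu_le_Im_e[of "Suc n"] mu t B_pos
      by (intro pd_le_of_bounds) (auto simp: R_def v)
    then have "(1 + pd (e (Suc n)) v) / (1 - pd (e (Suc n)) v) \<le> 2 / (1 - k)"
      using k pd_nonneg[of "e (Suc n)" v] by (intro frac_le) auto
    then have hv: "cmod (h v - u) \<le> 2 / (1 - k) * \<bar>cmod q - 1\<bar>"
      using holomorphic_norm_le_1_near_unimodular[OF h(1,2) u(1), of "e (Suc n)" v] t
        mult_right_mono[of _ _ "\<bar>cmod q - 1\<bar>"]
      by (fastforce simp: v hq u)
    have cay_near: "cmod (1 - cay s) \<le> 2 / (1 + Im s)" if "Im s > 0" for s
    proof -
      have "1 - cay s = 2 * \<i> / (s + \<i>)"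
        using plus_i_nz[OF that] by (simp add: cay_def field_simps)
      moreover have "1 + Im s \<le> cmod (s + \<i>)"
        using abs_Im_le_cmod[of "s + \<i>"] by simp
      ultimately show ?thesis
        using that by (simp add: norm_divide frac_le norm_mult)
    qed
    \<comment> \<open>Julia's lemma loses at most the factor \<open>Im (e n) \<ge> \<mu>\<close>
      after rescaling, so the image of \<open>v\<close> is still high and its Cayley value, like
      that of \<open>v\<close>, is close to 1.\<close>
    have "\<mu> * t \<le> Im (G n (Suc n) v)"
    proof -
      have "y (Suc n) * t \<le> y n * Im (G n (Suc n) v)"
        using Im_phi_ge[of "T (Suc n) v"] t unfolding phi_T by (simp add: v)
      then have "Im (e n) * t \<le> Im (G n (Suc n) v)"
        using y_pos[of n] by (simp add: Im_e field_simps)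
      then show ?thesis
        using mult_right_mono[OF mu_le_Im_e[of n], of t] t by linarith
    qed
    moreover have "\<mu> * t > 0" "\<mu> * t \<le> t"
      using mu t by auto
    ultimately have "2 / (1 + Im (G n (Suc n) v)) \<le> 2 / (\<mu> * t)" "2 / (1 + Im v) \<le> 2 / (\<mu> * t)"
      by (auto intro!: divide_left_mono simp: v)
    then have "cmod (cay (G n (Suc n) v) - cay v) \<le> 4 / (\<mu> * t)"
      using cay_near[of v] cay_near[of "G n (Suc n) v"] G_pos[of v n "Suc n"] t
        norm_triangle_ineq4[of "1 - cay v" "1 - cay (G n (Suc n) v)"]
      by (simp add: v)
    moreover have "cay (G n (Suc n) v) - cay v = (h v - 1) * cay v"
      using h(3)[of v] t by (simp add: v algebra_simps)
    ultimately have "cmod (h v - 1) * cmod (cay v) \<le> 4 / (\<mu> * t)"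
      by (simp add: norm_mult)
    moreover have "1 / 2 \<le> cmod (cay v)"
    proof -
      have "cay v = of_real ((t - 1) / (t + 1))"
      proof -
        have "cay v = (\<i> * of_real (t - 1)) / (\<i> * of_real (t + 1))"
          by (simp add: cay_def v_def algebra_simps)
        also have "\<dots> = of_real (t - 1) / of_real (t + 1)"
          by (rule mult_divide_mult_cancel_left) simp
        finally show ?thesis
          by (simp only: of_real_divide)
      qed
      then have "cmod (cay v) = \<bar>(t - 1) / (t + 1)\<bar>"
        by (metis norm_of_real)
      also have "\<dots> = (t - 1) / (t + 1)"
        using t by simp
      also have "\<dots> \<ge> 1 / 2"
        using t by (simp add: field_simps)
      finally show ?thesis .
    qed
    then have "cmod (h v - 1) * (1 / 2) \<le> cmod (h v - 1) * cmod (cay v)"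
      by (intro mult_left_mono) auto
    ultimately have hv1: "cmod (h v - 1) \<le> 8 / (\<mu> * t)"
      by simp
    have "cmod (q - 1) \<le> cmod (q - u) + cmod (h v - u) + cmod (h v - 1)"
      by (smt (verit, best) norm_minus_commute norm_triangle_sub diff_add_cancel norm_triangle_ineq add_diff_eq)
    also have "\<dots> \<le> K * \<bar>cmod q - 1\<bar> + 8 / (\<mu> * t)"
      using hv hv1 u by (simp add: K_def algebra_simps)
    also have "\<dots> < \<epsilon>"
      using qK tsmall by linarith
    finally show ?case
      by (simp add: dist_norm q_def)
  qed
qed

text \<open>On the box containing all \<open>e n\<close>, undoing \<open>cay\<close> costs only a
  bounded factor. Small increments later prevent \<open>Re (e n)\<close> from changing sign.\<close>

lemma e_consecutive: "(\<lambda>n. e n - e (Suc n)) \<longlonglongrightarrow> 0"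
proof (rule tendsto_norm_zero_cancel, rule tendsto_sandwich[OF _ _ tendsto_const])
  let ?q = "\<lambda>n. cay (e n) / cay (e (Suc n))"
  have "(\<lambda>n. (2 + B)\<^sup>2 / 2 * cmod (?q n - 1)) \<longlonglongrightarrow> (2 + B)\<^sup>2 / 2 * cmod (1 - 1)"
    by (intro tendsto_intros cay_e_quotient)
  then show "(\<lambda>n. (2 + B)\<^sup>2 / 2 * cmod (?q n - 1)) \<longlonglongrightarrow> 0"
    by simp
  show "eventually (\<lambda>n. cmod (e n - e (Suc n)) \<le> (2 + B)\<^sup>2 / 2 * cmod (?q n - 1)) sequentially"
    using eventually_sequentially_Suc[THEN iffD2, OF e_ne_i]
  proof eventually_elim
    case (elim n)
    have "cay (e n) - cay (e (Suc n)) = (?q n - 1) * cay (e (Suc n))"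
      using elim by (simp add: algebra_simps cay_eq_0_iff)
    then have 1: "cmod (cay (e n) - cay (e (Suc n))) \<le> cmod (?q n - 1)"
      using pd_less_1[of \<i> "e (Suc n)"] by (simp add: norm_mult norm_cay mult_left_le)
    have plus: "cmod (e m + \<i>) \<le> 2 + B" for m
      using norm_triangle_ineq[of "e m" \<i>] norm_e_le[of m] by simp
    have "e n - e (Suc n) = (cay (e n) - cay (e (Suc n))) * ((e n + \<i>) * (e (Suc n) + \<i>)) / (2 * \<i>)"
      using plus_i_nz[of "e n"] plus_i_nz[of "e (Suc n)"] by (simp add: cay_diff)
    then have "cmod (e n - e (Suc n)) =
        cmod (cay (e n) - cay (e (Suc n))) * (cmod (e n + \<i>) * cmod (e (Suc n) + \<i>)) / 2"
      by (simp add: norm_mult norm_divide)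
    also have "\<dots> \<le> cmod (?q n - 1) * ((2 + B) * (2 + B)) / 2"
      using 1 plus B_pos by (intro divide_right_mono mult_mono) auto
    finally show ?case
      by (simp add: power2_eq_square mult_ac)
  qed
qed auto

section \<open>Consecutive heights are asymptotically equal\<close>

text \<open>High on an arc \<open>G n (Suc n)\<close> is nearly the identity, so there
  \<open>\<phi>\<close> is nearly the affine map taking the scale of \<open>w (Suc n)\<close> to
  that of \<open>w n\<close>, with expansion factor \<open>y n / y (Suc n)\<close>. The half-disc
  estimate extends the gain in height to points near the real axis.\<close>

lemma phi_growth:
  assumes \<delta>: "0 < \<delta>" "\<delta> < 1" and C: "C \<ge> 1"
  shows "eventually (\<lambda>n. y (Suc n) \<le> (1 - \<delta>) * y n \<longrightarrow>
    (\<forall>v. Im v > 0 \<longrightarrow> cmod (v - of_real (x (Suc n))) \<le> C * y (Suc n) \<longrightarrow> (1 + \<delta> / 3) * Im v \<le> Im (\<phi> v))) sequentially"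
proof -
  \<comment> \<open>A hyperbolic displacement \<open>k\<close> at height at most
    \<open>2 * C\<close> is a Euclidean one of at most
    \<open>4 * k * (2 * C) = \<delta> / 5\<close>.\<close>
  define k where "k = \<delta> / (40 * C)"
  have k: "0 < k" "k \<le> 1 / 2" "8 * C * k = \<delta> / 5"
    using \<delta> C by (auto simp: k_def field_simps)
  obtain \<eta> where \<eta>: "\<eta> > 0"
    and near: "\<And>g c z. g holomorphic_on uhp \<Longrightarrow> (\<And>z. Im z > 0 \<Longrightarrow> Im (g z) > 0) \<Longrightarrow> g \<i> = \<i> \<Longrightarrow>
      c \<noteq> \<i> \<Longrightarrow> \<mu> \<le> Im c \<Longrightarrow> cmod c \<le> 2 * C + 1 + B \<Longrightarrow> cmod (cay (g c) / cay c - 1) \<le> \<eta> \<Longrightarrow>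
      \<mu> \<le> Im z \<Longrightarrow> cmod z \<le> 2 * C + 1 + B \<Longrightarrow> pd (g z) z \<le> k"
    using near_identity_uniform[of \<mu> "2 * C + 1 + B" k] mu B_pos C k by (smt (verit) zero_le_mult_iff)
  have "eventually (\<lambda>n. dist (cay (e n) / cay (e (Suc n))) 1 < \<eta>) sequentially"
    using cay_e_quotient \<eta> by (rule tendstoD)
  then show ?thesis
    using eventually_sequentially_Suc[THEN iffD2, OF e_ne_i]
  proof eventually_elim
    case (elim n)
    have gz: "cmod (G n (Suc n) z - z) \<le> \<delta> / 5" if z: "cmod z = 2 * C" "C \<le> Im z" for z
    proof -
      have pos: "Im z > 0"
        using z C by auto
      have "pd (G n (Suc n) z) z \<le> k"
        using elim mu_le_Im_e[of "Suc n"] norm_e_le[of "Suc n"] z C mu B_pos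
        by (intro near[of "G n (Suc n)" "e (Suc n)"] G_hol G_pos G_i) (auto simp: G_e dist_norm)
      then have "cmod (G n (Suc n) z - z) \<le> 2 * k / (1 - k) * Im z"
        using pos k by (intro pd_le_imp(2) G_pos) (auto simp: pd_commute)
      also have "\<dots> \<le> 4 * k * (2 * C)"
        using abs_Im_le_cmod[of z] z k pos by (intro mult_mono) (auto simp: field_simps)
      also have "\<dots> = 8 * C * k"
        by simp
      finally show ?thesis
        using k(3) by simp
    qed
    show ?case
    proof (intro impI allI)
      fix v
      assume yd: "y (Suc n) \<le> (1 - \<delta>) * y n" and v: "Im v > 0" "cmod (v - of_real (x (Suc n))) \<le> C * y (Suc n)"
      define D where "D = y n - y (Suc n)"
      have D: "\<delta> * y n \<le> D" "D > 0"
        using yd mult_pos_pos[OF \<delta>(1) y_pos[of n]] by (auto simp: D_def algebra_simps)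
      \<comment> \<open>The gain in height, normalised for the half-disc estimate with radius
        \<open>2 * C\<close>. On the upper arc the approximation error is at most
        \<open>D / 5 \<le> D / 5 * Im z\<close>, which leaves \<open>4 / 5 * D * Im z\<close>; then
        \<open>5 / 12 * (4 / 5) = 1 / 3\<close> is the constant in the claim.\<close>
      define f where "f = (\<lambda>z. (\<phi> (T (Suc n) z) - T (Suc n) z) / of_real (4 / 5 * D))"
      have Imf: "Im (f z) = (Im (\<phi> (T (Suc n) z)) - y (Suc n) * Im z) / (4 / 5 * D)" for z
        unfolding f_def by (simp only: Im_divide_of_real minus_complex.sel Im_T)
      have "(\<phi> \<circ> T (Suc n)) holomorphic_on uhp"
        by (intro holomorphic_on_compose_gen[of _ _ \<phi> uhp] T_hol phi_hol) auto
      then have "f holomorphic_on uhp"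
        unfolding f_def using D by (intro holomorphic_intros T_hol) (auto simp: o_def)
      moreover have "0 \<le> Im (f z)" if "Im z > 0" for z
        using Im_phi_ge[of "T (Suc n) z"] that D by (simp add: Imf)
      moreover have "Im z \<le> Im (f z)" if z: "cmod z = 2 * C" "2 * C / 2 \<le> Im z" for z
      proof -
        have "\<bar>Im (G n (Suc n) z - z)\<bar> \<le> \<delta> / 5"
          using gz[of z] z abs_Im_le_cmod[of "G n (Suc n) z - z"] by simp
        then have "Im z - \<delta> / 5 \<le> Im (G n (Suc n) z)"
          unfolding minus_complex.sel by linarith
        then have "y n * (Im z - \<delta> / 5) \<le> y n * Im (G n (Suc n) z)"
          by (intro mult_left_mono) (auto intro: less_imp_le)
        then have "D * Im z - \<delta> * y n / 5 \<le> Im (\<phi> (T (Suc n) z)) - y (Suc n) * Im z"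
          by (simp add: phi_T D_def algebra_simps)
        moreover have "D * 1 \<le> D * Im z"
          using D z C by (intro mult_left_mono) auto
        ultimately have "4 / 5 * D * Im z \<le> Im (\<phi> (T (Suc n) z)) - y (Suc n) * Im z"
          using D by linarith
        then show ?thesis
          using D by (simp add: Imf field_simps)
      qed
      moreover have "cmod (S (Suc n) v) \<le> C"
        using v by (simp add: S_def norm_divide abs_of_pos pos_divide_le_eq)
      ultimately have "5 / 12 * Im (S (Suc n) v) \<le> Im (f (S (Suc n) v))"
        using C v by (intro Im_lower_bound_half_disc[of f "2 * C"]) auto
      then have "5 / 12 * (Im v / y (Suc n)) * (4 / 5 * D) \<le> Im (\<phi> v) - Im v"
        using D by (simp add: Imf pos_le_divide_eq)
      moreover have "\<delta> / 3 * Im v \<le> 5 / 12 * (Im v / y (Suc n)) * (4 / 5 * D)"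
      proof -
        have "\<delta> * y (Suc n) \<le> D"
          using D(1) mult_left_mono[OF y_Suc_le[of n], of \<delta>] \<delta> by linarith
        then have "\<delta> * y (Suc n) * (Im v / y (Suc n)) \<le> D * (Im v / y (Suc n))"
          using v by (intro mult_right_mono) (auto intro: less_imp_le)
        then show ?thesis
          by simp
      qed
      ultimately show "(1 + \<delta> / 3) * Im v \<le> Im (\<phi> v)"
        by (simp add: algebra_simps)
    qed
  qed
qed

text \<open>If the heights dropped by a definite factor at a late step, the growth of \<^term>\<open>\<phi>\<close> would
  persist over a half-disc large enough to contain the rest of the orbit, whose heights would then
  decay geometrically; the orbit would stay bounded.\<close>

lemma Im_e_lim: "(\<lambda>n. Im (e n)) \<longlonglongrightarrow> 1"
proof (rule ccontr)
  assume "\<not> (\<lambda>n. Im (e n)) \<longlonglongrightarrow> 1"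
  then obtain \<delta>0 where \<delta>0: "\<delta>0 > 0" "frequently (\<lambda>n. \<not> dist (Im (e n)) 1 < \<delta>0) sequentially"
    by (auto simp: tendsto_iff not_eventually)
  define \<delta> where "\<delta> = min \<delta>0 (1 / 2)"
  have \<delta>: "0 < \<delta>" "\<delta> < 1" "\<delta> \<le> \<delta>0"
    using \<delta>0 by (auto simp: \<delta>_def)
  \<comment> \<open>\<open>L\<close> is the sum of the geometric series with first term
    \<open>B\<close> and ratio \<open>1 / (1 + \<delta> / 3)\<close>: it bounds the remaining path
    length in units of the current height. The extra \<open>B\<close> in \<open>C\<close> admits the
    next orbit point, at which the growth estimate is applied.\<close>
  define L where "L = B * (1 + \<delta> / 3) / (\<delta> / 3)"
  define C where "C = 1 + L + B"
  have L: "L > 0" and C: "C \<ge> 1"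
    using \<delta> B_pos by (auto simp: L_def C_def)
  \<comment> \<open>A single sufficiently late drop is enough; the growth it causes governs the
    whole tail.\<close>
  from frequently_ex[OF frequently_eventually_frequently[OF \<delta>0(2) phi_growth[OF \<delta>(1,2) C]]]
  obtain n where n: "\<not> dist (Im (e n)) 1 < \<delta>0"
    and growth: "y (Suc n) \<le> (1 - \<delta>) * y n \<Longrightarrow> Im v > 0 \<Longrightarrow>
      cmod (v - of_real (x (Suc n))) \<le> C * y (Suc n) \<Longrightarrow> (1 + \<delta> / 3) * Im v \<le> Im (\<phi> v)" for v
    by blast
  have "Im (e n) \<le> 1 - \<delta>"
    using n Im_e_le[of n] \<delta> by (simp add: dist_real_def)
  then have drop: "y (Suc n) \<le> (1 - \<delta>) * y n"
    by (simp add: Im_e pos_divide_le_eq)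
  define N where "N = Suc n"
  \<comment> \<open>The left side does not increase with \<open>k\<close>: the loss in
    \<open>L * y\<close> pays for each step of length at most \<open>B * y\<close>.\<close>
  have bound: "cmod (w (N + k) - of_real (x N)) + L * y (N + k) \<le> (1 + L) * y N" for k
  proof (induction k)
    case 0
    have "w N - of_real (x N) = \<i> * of_real (y N)"
      by (simp add: complex_eq_iff)
    then have "cmod (w N - of_real (x N)) = y N"
      by (simp add: norm_mult abs_of_pos)
    then show ?case
      by (simp add: algebra_simps)
  next
    case (Suc k)
    define v where "v = w (N + Suc k)"
    have step: "cmod (v - of_real (x N)) \<le> cmod (w (N + k) - of_real (x N)) + B * y (N + k)"
      using w_step_le[of "N + k"] norm_triangle_ineq[of "v - w (N + k)" "w (N + k) - of_real (x N)"]
      by (simp add: v_def)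
    moreover have "L * y (N + k) > 0" "B * y (N + k) \<le> B * y N"
      using L B_pos y_antimono[of N "N + k"] by (auto intro: mult_left_mono)
    ultimately have "cmod (v - of_real (x N)) \<le> C * y N"
      using Suc by (simp add: C_def algebra_simps)
    then have "(1 + \<delta> / 3) * Im v \<le> Im (\<phi> v)"
      using drop by (intro growth) (auto simp: N_def v_def)
    then have *: "(1 + \<delta> / 3) * Im v \<le> y (N + k)"
      by (simp add: v_def phi_w)
    have "B * y (N + k) + L * Im v \<le> L * y (N + k)"
    proof -
      have "L = B / (\<delta> / 3) + B"
        using \<delta> by (simp add: L_def field_simps)
      then have "L * (y (N + k) - Im v) - B * y (N + k) = B / (\<delta> / 3) * (y (N + k) - (1 + \<delta> / 3) * Im v)"
        unfolding \<open>L = B / (\<delta> / 3) + B\<close> using \<delta> by (simp add: field_simps)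
      moreover have "B / (\<delta> / 3) * (y (N + k) - (1 + \<delta> / 3) * Im v) \<ge> 0"
        using * B_pos \<delta> by (intro mult_nonneg_nonneg) auto
      ultimately show ?thesis
        by (simp add: algebra_simps)
    qed
    then show ?case
      using step Suc by (simp add: v_def)
  qed
  have "cmod (w (N + k)) \<le> \<bar>x N\<bar> + (1 + L) * y N" for k
  proof -
    have "L * y (N + k) > 0"
      using L by simp
    then have "cmod (w (N + k) - of_real (x N)) \<le> (1 + L) * y N"
      using bound[of k] by linarith
    moreover have "cmod (w (N + k)) \<le> cmod (w (N + k) - of_real (x N)) + \<bar>x N\<bar>"
      using norm_triangle_ineq[of "w (N + k) - of_real (x N)" "of_real (x N)"] by simp
    ultimately show ?thesis
      by linarith
  qed
  moreover have "eventually (\<lambda>n. cmod (w n) > \<bar>x N\<bar> + (1 + L) * y N) sequentially"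
    using filterlim_at_infinity_imp_norm_at_top[OF w_infinity] by (simp add: filterlim_at_top_dense)
  then obtain M where "\<And>n. n \<ge> M \<Longrightarrow> cmod (w n) > \<bar>x N\<bar> + (1 + L) * y N"
    by (auto simp: eventually_sequentially)
  ultimately show False
    by (meson le_add2 linorder_not_le)
qed

section \<open>The limit of the normalised steps\<close>

text \<open>The positive solution of \<open>pd \<i> (\<i> + b0) = a\<close>, hence up to sign the
  only possible limit of \<open>Re (e n)\<close> once the heights are equal in the limit.\<close>

definition b0 :: real where "b0 = 2 * a / sqrt (1 - a\<^sup>2)"

lemma b0_pos: "b0 > 0"
  using a_pos a_less by (simp add: b0_def abs_square_less_1)

text \<open>The cosine of \<open>Arg (w n)\<close> tends to 1, so the orbit escapes to the right.
  This decides the sign in \<open>Re_e_lim\<close>.\<close>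

lemma x_lim: "filterlim x at_top sequentially"
proof -
  have "(\<lambda>n. cos (Arg (w n))) \<longlonglongrightarrow> cos 0"
    by (intro tendsto_intros w_Arg)
  then have "filterlim (\<lambda>n. cos (Arg (w n)) * cmod (w n)) at_top sequentially"
    by (intro filterlim_tendsto_pos_mult_at_top[of _ "cos 0"] filterlim_at_infinity_imp_norm_at_top w_infinity) auto
  moreover have "cos (Arg (w n)) * cmod (w n) = x n" for n
  proof -
    have "w n \<noteq> 0"
      using y_pos[of n] by (metis less_irrefl zero_complex.sel(2))
    then show ?thesis
      by (simp add: cos_Arg)
  qed
  ultimately show ?thesis
    by simp
qed

text \<open>The distance \<open>pd \<i> (e n)\<close> and the height \<open>Im (e n)\<close>
  determine \<open>(Re (e n))\<^sup>2\<close>, and both converge.\<close>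

lemma abs_Re_e_lim: "(\<lambda>n. \<bar>Re (e n)\<bar>) \<longlonglongrightarrow> b0"
proof -
  let ?d = "\<lambda>n. pd \<i> (e n)"
  have less: "(?d n)\<^sup>2 < 1" for n
    using pd_e_le[of n] a_less by (simp add: abs_square_less_1)
  have eq: "\<bar>Re (e n)\<bar> = sqrt (((?d n)\<^sup>2 * (Im (e n) + 1)\<^sup>2 - (Im (e n) - 1)\<^sup>2) / (1 - (?d n)\<^sup>2))" for n
  proof -
    have "(cmod (e n - \<i>))\<^sup>2 = (?d n)\<^sup>2 * (cmod (e n + \<i>))\<^sup>2"
      using norm_diff_le_pd[of \<i> "e n"] by (simp add: power_mult_distrib)
    then have "(Re (e n))\<^sup>2 + (Im (e n) - 1)\<^sup>2 = (?d n)\<^sup>2 * ((Re (e n))\<^sup>2 + (Im (e n) + 1)\<^sup>2)"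
      unfolding cmod_power2 by simp
    then have "(Re (e n))\<^sup>2 * (1 - (?d n)\<^sup>2) = (?d n)\<^sup>2 * (Im (e n) + 1)\<^sup>2 - (Im (e n) - 1)\<^sup>2"
      by (simp add: algebra_simps)
    then have "(Re (e n))\<^sup>2 = ((?d n)\<^sup>2 * (Im (e n) + 1)\<^sup>2 - (Im (e n) - 1)\<^sup>2) / (1 - (?d n)\<^sup>2)"
      using less[of n] by (simp add: eq_divide_eq)
    then show ?thesis
      by (metis real_sqrt_abs)
  qed
  have a2: "a\<^sup>2 < 1"
    using a_pos a_less by (simp add: abs_square_less_1)
  have "(\<lambda>n. sqrt (((?d n)\<^sup>2 * (Im (e n) + 1)\<^sup>2 - (Im (e n) - 1)\<^sup>2) / (1 - (?d n)\<^sup>2)))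
      \<longlonglongrightarrow> sqrt ((a\<^sup>2 * (1 + 1)\<^sup>2 - (1 - 1)\<^sup>2) / (1 - a\<^sup>2))"
    using a2 by (intro tendsto_intros pd_e_lim Im_e_lim) auto
  also have "sqrt ((a\<^sup>2 * (1 + 1)\<^sup>2 - (1 - 1)\<^sup>2) / (1 - a\<^sup>2)) = b0"
    using a_pos by (simp add: b0_def real_sqrt_divide real_sqrt_mult)
  finally show ?thesis
    by (simp only: eq)
qed

text \<open>Eventually \<open>Re (e n)\<close> avoids the interval from \<open>- b0 / 2\<close> to
  \<open>b0 / 2\<close> and moves by less than its length, so its sign is frozen. A negative sign
  would keep \<open>x\<close> bounded above.\<close>

lemma Re_e_lim: "(\<lambda>n. Re (e n)) \<longlonglongrightarrow> b0"
proof -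
  have "eventually (\<lambda>n. \<bar>Re (e n)\<bar> > b0 / 2) sequentially"
    using abs_Re_e_lim b0_pos by (intro order_tendstoD(1)) auto
  moreover have "eventually (\<lambda>n. dist (e n - e (Suc n)) 0 < b0) sequentially"
    using e_consecutive b0_pos by (rule tendstoD)
  ultimately have "eventually (\<lambda>n. \<bar>Re (e n)\<bar> > b0 / 2 \<and> \<bar>Re (e n) - Re (e (Suc n))\<bar> < b0) sequentially"
  proof eventually_elim
    case (elim n)
    then show ?case
      using abs_Re_le_cmod[of "e n - e (Suc n)"] by (simp add: dist_norm)
  qed
  then obtain N where N: "\<And>n. n \<ge> N \<Longrightarrow> \<bar>Re (e n)\<bar> > b0 / 2 \<and> \<bar>Re (e n) - Re (e (Suc n))\<bar> < b0"
    by (auto simp: eventually_sequentially)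
  have pos: "Re (e n) > 0" if n: "n \<ge> N" for n
  proof (rule ccontr)
    assume neg: "\<not> Re (e n) > 0"
    have neg: "Re (e (n + k)) < 0" for k
    proof (induction k)
      case 0
      then show ?case
        using neg N[OF n] b0_pos by simp
    next
      case (Suc k)
      then show ?case
        using N[of "n + k"] N[of "n + Suc k"] n by simp linarith
    qed
    have le: "x (n + k) \<le> x n" for k
    proof (induction k)
      case (Suc k)
      have "x (Suc (n + k)) < x (n + k)"
        using neg[of k] y_pos[of "n + k"] unfolding Re_e divide_less_0_iff by linarith
      then show ?case
        using Suc by simp
    qed simp
    have "eventually (\<lambda>m. x m > x n) sequentially"
      using x_lim by (simp add: filterlim_at_top_dense)
    then obtain M where M: "\<And>m. m \<ge> M \<Longrightarrow> x m > x n"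
      by (auto simp: eventually_sequentially)
    show False
      using M[of "n + M"] le[of M] by simp
  qed
  show ?thesis
  proof (rule Lim_transform_eventually[OF abs_Re_e_lim])
    show "eventually (\<lambda>n. \<bar>Re (e n)\<bar> = Re (e n)) sequentially"
      using eventually_ge_at_top[of N] by eventually_elim (use pos in \<open>auto simp: abs_of_pos\<close>)
  qed
qed

lemma e_lim: "e \<longlonglongrightarrow> \<i> + of_real b0"
  unfolding tendsto_complex_iff using Re_e_lim Im_e_lim by simp

section \<open>The limit map\<close>

definition F :: "nat \<Rightarrow> complex \<Rightarrow> complex" where
  "F n z = (\<phi> ^^ n) (T n z)"

lemma F_hol: "F n holomorphic_on uhp"
proof -
  have "(\<phi> ^^ n \<circ> T n) holomorphic_on uhp"
    using funpow_hol by (intro holomorphic_on_compose_gen[of "T n" _ _ uhp] T_hol) auto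
  then show ?thesis
    by (simp add: F_def[abs_def] o_def)
qed

lemma F_pos: "Im z > 0 \<Longrightarrow> Im (F n z) > 0"
  using funpow_pos[of "T n z"] by (simp add: F_def)

lemma F_S_w: "F n (S n (w (n + k))) = w k"
  by (simp add: F_def funpow_w)

lemma F_i: "F n \<i> = w 0"
  using F_S_w[of n 0] by simp

text \<open>Two of the approximants differ by precomposition with \<open>G m n\<close>; Schwarz-Pick
  for \<open>F m\<close> then bounds their distance by that from \<open>G m n z\<close> to
  \<open>z\<close>.\<close>

lemma F_G:
  assumes "m \<le> n"
  shows "F m (G m n z) = F n z"
proof -
  have "\<phi> ^^ n = \<phi> ^^ m \<circ> \<phi> ^^ (n - m)"
    using assms by (simp flip: funpow_add)
  then show ?thesis
    by (simp add: F_def G_def)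
qed

lemma F_uniformly_Cauchy:
  assumes \<nu>: "0 < \<nu>" "\<nu> \<le> \<mu>" and R: "1 + B \<le> R"
  shows "uniformly_Cauchy_on {z. \<nu> \<le> Im z \<and> cmod z \<le> R} F"
proof (rule uniformly_Cauchy_onI')
  fix \<epsilon> :: real assume \<epsilon>: "\<epsilon> > 0"
  define k where "k = sqrt (1 - \<nu>\<^sup>2 / R\<^sup>2)"
  have "\<nu>\<^sup>2 \<le> R\<^sup>2"
    using \<nu> R mu B_pos by (intro power_mono) auto
  then have k: "0 \<le> k" "k < 1"
    using \<nu> R B_pos by (auto simp: k_def)
  \<comment> \<open>All \<open>F n\<close> send \<open>\<i>\<close> to \<open>w 0\<close>, so they
    map the box into one hyperbolic disc about \<open>w 0\<close>; \<open>R'\<close> bounds the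
    modulus there.\<close>
  define R' where "R' = 2 * k / (1 - k) * y 0 + cmod (w 0)"
  have R': "R' > 0"
    using k y_pos[of 0] by (auto simp: R'_def intro!: add_nonneg_pos simp del: y_pos)
  have bound: "cmod (F n z) \<le> R'" if "\<nu> \<le> Im z" "cmod z \<le> R" for n z
  proof -
    have z: "Im z > 0"
      using that \<nu> by simp
    have "pd (F n \<i>) (F n z) \<le> pd \<i> z"
      using z by (intro schwarz_pick_uhp F_hol F_pos) auto
    also have "\<dots> \<le> k"
      unfolding k_def using that \<nu> R mu B_pos by (intro pd_le_of_bounds) auto
    finally have "cmod (F n z - w 0) \<le> 2 * k / (1 - k) * y 0"
      using k z by (intro pd_le_imp(2) F_pos) (auto simp: F_i)
    then show ?thesis
      using norm_triangle_ineq[of "F n z - w 0" "w 0"] by (simp add: R'_def)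
  qed
  define \<epsilon>' where "\<epsilon>' = \<epsilon> / (4 * R')"
  have \<epsilon>': "\<epsilon>' > 0"
    using \<epsilon> R' by (simp add: \<epsilon>'_def)
  obtain \<eta> where \<eta>: "\<eta> > 0"
    and near: "\<And>g c z. g holomorphic_on uhp \<Longrightarrow> (\<And>z. Im z > 0 \<Longrightarrow> Im (g z) > 0) \<Longrightarrow> g \<i> = \<i> \<Longrightarrow>
      c \<noteq> \<i> \<Longrightarrow> \<nu> \<le> Im c \<Longrightarrow> cmod c \<le> R \<Longrightarrow> cmod (cay (g c) / cay c - 1) \<le> \<eta> \<Longrightarrow>
      \<nu> \<le> Im z \<Longrightarrow> cmod z \<le> R \<Longrightarrow> pd (g z) z \<le> \<epsilon>'"
    using near_identity_uniform[of \<nu> R \<epsilon>'] mu B_pos \<nu> R \<epsilon>' by (smt (verit))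
  have "cay (\<i> + of_real b0) \<noteq> 0"
    using b0_pos by (simp add: cay_eq_0_iff)
  moreover have cay_lim: "(\<lambda>n. cay (e n)) \<longlonglongrightarrow> cay (\<i> + of_real b0)"
    by (intro tendsto_cay e_lim) simp
  ultimately have "((\<lambda>p. cay (e (fst p)) / cay (e (snd p))) \<longlongrightarrow>
      cay (\<i> + of_real b0) / cay (\<i> + of_real b0)) (sequentially \<times>\<^sub>F sequentially)"
    \<comment> \<open>The indices grow independently, so this needs the limit of \<open>e\<close>
      and not merely quotients of consecutive terms.\<close>
    by (intro tendsto_divide filterlim_compose[OF cay_lim] filterlim_fst filterlim_snd)
  then have "((\<lambda>p. cay (e (fst p)) / cay (e (snd p))) \<longlongrightarrow> 1) (sequentially \<times>\<^sub>F sequentially)"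
    using \<open>cay (\<i> + of_real b0) \<noteq> 0\<close> by simp
  from tendstoD[OF this \<eta>] obtain N1 where
    N1: "\<And>m n. m \<ge> N1 \<Longrightarrow> n \<ge> N1 \<Longrightarrow> dist (cay (e m) / cay (e n)) 1 < \<eta>"
    by (auto simp: eventually_prod_sequentially)
  obtain N2 where N2: "\<And>n. n \<ge> N2 \<Longrightarrow> e n \<noteq> \<i>"
    using e_ne_i by (auto simp: eventually_sequentially)
  show "\<exists>M. \<forall>z\<in>{z. \<nu> \<le> Im z \<and> cmod z \<le> R}. \<forall>m\<ge>M. \<forall>n>m. dist (F m z) (F n z) < \<epsilon>"
  proof (intro exI ballI allI impI)
    fix z m n assume z: "z \<in> {z. \<nu> \<le> Im z \<and> cmod z \<le> R}" and m: "m \<ge> max N1 N2" and n: "n > m"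
    then have pos: "Im z > 0"
      using \<nu> by auto
    have "pd (F m (G m n z)) (F m z) \<le> pd (G m n z) z"
      using pos by (intro schwarz_pick_uhp F_hol F_pos G_pos)
    also have "\<dots> \<le> \<epsilon>'"
      using m n N1[of m n] N2[of n] mu_le_Im_e[of n] norm_e_le[of n] z \<nu> R
      by (intro near[of "G m n" "e n"] G_hol G_pos G_i) (auto simp: G_e dist_norm)
    finally have "pd (F n z) (F m z) \<le> \<epsilon>'"
      using n by (simp add: F_G)
    moreover have "cmod (F m z - cnj (F n z)) \<le> 2 * R'"
      using norm_triangle_ineq4[of "F m z" "cnj (F n z)"] bound[of z m] bound[of z n] z by simp
    ultimately have "cmod (F m z - F n z) \<le> \<epsilon>' * (2 * R')"
      using norm_diff_le_pd[of "F n z" "F m z"] F_pos[OF pos] \<epsilon>' by (simp add: mult_mono)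
    also have "\<dots> < \<epsilon>"
      using \<epsilon> R' by (simp add: \<epsilon>'_def)
    finally show "dist (F m z) (F n z) < \<epsilon>"
      by (simp add: dist_norm)
  qed
qed

lemma box_around:
  assumes "Im z > 0"
  obtains \<nu> R where "0 < \<nu>" "\<nu> \<le> \<mu>" "1 + B \<le> R"
    "cball z (Im z / 2) \<subseteq> {z. \<nu> \<le> Im z \<and> cmod z \<le> R}"
proof (rule that)
  show "0 < min \<mu> (Im z / 2)" "min \<mu> (Im z / 2) \<le> \<mu>" "1 + B \<le> max (1 + B) (cmod z + Im z / 2)"
    using assms mu by auto
  show "cball z (Im z / 2) \<subseteq> {v. min \<mu> (Im z / 2) \<le> Im v \<and> cmod v \<le> max (1 + B) (cmod z + Im z / 2)}"
  proof
    fix v assume "v \<in> cball z (Im z / 2)"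
    then have v: "cmod (z - v) \<le> Im z / 2"
      by (simp add: dist_norm)
    then have "\<bar>Im z - Im v\<bar> \<le> Im z / 2"
      using abs_Im_le_cmod[of "z - v"] by simp
    then have "Im z / 2 \<le> Im v"
      by linarith
    moreover have "cmod v \<le> cmod z + Im z / 2"
      using v norm_triangle_ineq4[of z "z - v"] by simp
    ultimately show "v \<in> {v. min \<mu> (Im z / 2) \<le> Im v \<and> cmod v \<le> max (1 + B) (cmod z + Im z / 2)}"
      by (auto simp: min_le_iff_disj le_max_iff_disj)
  qed
qed

section \<open>Asymptotics along the orbit\<close>

text \<open>Seen from \<open>w n\<close>, each further step is an affine image of
  \<open>e (n + k)\<close>. In the limit the scale stays 1 and every step is the translation by
  \<open>b0\<close>.\<close>

lemma S_w_lim: "(\<lambda>n. S n (w (n + k))) \<longlonglongrightarrow> \<i> + of_nat k * of_real b0"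
proof (induction k)
  case 0
  then show ?case by simp
next
  case (Suc k)
  let ?p = "\<lambda>n. S n (w (n + k))"
  have "S n (w (n + Suc k)) = of_real (Re (?p n)) + of_real (Im (?p n)) * e (n + k)" for n
    by (simp add: complex_eq_iff Re_e Im_e field_simps)
  moreover have "(\<lambda>n. of_real (Re (?p n)) + of_real (Im (?p n)) * e (n + k)) \<longlonglongrightarrow>
      of_real (Re (\<i> + of_nat k * of_real b0)) + of_real (Im (\<i> + of_nat k * of_real b0)) * (\<i> + of_real b0)"
    by (intro tendsto_intros Suc LIMSEQ_ignore_initial_segment[OF e_lim])
  ultimately show ?case
    by (simp add: algebra_simps)
qed

text \<open>The increments of \<open>x\<close> are eventually at least \<open>b0 / 2\<close> times
  the current height, and heights do not increase, so \<open>n - N\<close> steps cover at least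
  \<open>(n - N) * b0 / 2 * y n\<close>.\<close>

lemma index_times_y_le: "eventually (\<lambda>n. real n * y n \<le> (1 + 2 / b0) * x n) sequentially"
proof -
  have "eventually (\<lambda>n. Re (e n) > b0 / 2) sequentially"
    using Re_e_lim b0_pos by (intro order_tendstoD(1)) auto
  then obtain N where N: "\<And>n. n \<ge> N \<Longrightarrow> Re (e n) > b0 / 2"
    by (auto simp: eventually_sequentially)
  have step: "b0 / 2 * y n \<le> x (Suc n) - x n" if "n \<ge> N" for n
    using N[OF that] y_pos[of n] unfolding Re_e by (simp add: pos_less_divide_eq less_imp_le del: y_pos)
  have sum: "real k * (b0 / 2 * y (N + k)) \<le> x (N + k) - x N" for k
  proof (induction k)
    case (Suc k)
    have "b0 / 2 * y (N + Suc k) \<le> b0 / 2 * y (N + k)"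
      using y_Suc_le[of "N + k"] b0_pos by (intro mult_left_mono) auto
    then have "real k * (b0 / 2 * y (N + Suc k)) \<le> real k * (b0 / 2 * y (N + k))"
      "b0 / 2 * y (N + Suc k) \<le> x (N + Suc k) - x (N + k)"
      using step[of "N + k"] by (auto intro!: mult_left_mono)
    moreover have "real (Suc k) * (b0 / 2 * y (N + Suc k)) =
        b0 / 2 * y (N + Suc k) + real k * (b0 / 2 * y (N + Suc k))"
      by (simp add: algebra_simps)
    ultimately show ?case
      using Suc by linarith
  qed simp
  \<comment> \<open>The contribution of the first \<open>N\<close> indices and of \<open>x N\<close>
    is absorbed into one further \<open>x n\<close>, the 1 in \<open>1 + 2 / b0\<close>.\<close>
  have "eventually (\<lambda>n. x n > real N * y 0 - 2 / b0 * x N) sequentially"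
    using x_lim by (simp add: filterlim_at_top_dense)
  then show ?thesis
    using eventually_ge_at_top[of N]
  proof eventually_elim
    case (elim n)
    define k where "k = n - N"
    have n: "n = N + k"
      using elim by (simp add: k_def)
    have "2 / b0 * (real k * (b0 / 2 * y n)) \<le> 2 / b0 * (x n - x N)"
      using sum[of k] b0_pos unfolding n by (intro mult_left_mono) auto
    then have "real k * y n \<le> 2 / b0 * x n - 2 / b0 * x N"
      using b0_pos by (simp add: right_diff_distrib)
    moreover have "real N * y n \<le> real N * y 0"
      using y_antimono[of 0 n] by (intro mult_left_mono) auto
    moreover have "real n * y n = real N * y n + real k * y n"
      by (simp add: n algebra_simps)
    ultimately have "real n * y n \<le> x n + 2 / b0 * x n"
      using elim by linarith
    then show ?case
      by (simp add: algebra_simps)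
  qed
qed

lemma S_deriv:
  assumes "(f has_field_derivative D) (at z)"
  shows "((\<lambda>z. S n (f z)) has_field_derivative D / of_real (y n)) (at z)"
  unfolding S_def using DERIV_cdivide[OF DERIV_diff[OF assms DERIV_const]] by simp

text \<open>By the chain rule \<open>deriv (G n (Suc n)) \<i> = deriv \<phi> (w (Suc n)) * Im (e
  n)\<close>. The left side tends to 1 by \<open>near_identity\<close>, and so does
  \<open>Im (e n)\<close>.\<close>

lemma deriv_phi_lim: "(\<lambda>n. deriv \<phi> (w n)) \<longlonglongrightarrow> 1"
proof (rule LIMSEQ_imp_Suc)
  let ?q = "\<lambda>n. cay (e n) / cay (e (Suc n))"
  have "(\<lambda>n. deriv (G n (Suc n)) \<i> - 1) \<longlonglongrightarrow> 0"
  proof (rule tendsto_norm_zero_cancel, rule tendsto_sandwich[OF _ _ tendsto_const])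
    show "eventually (\<lambda>n. cmod (deriv (G n (Suc n)) \<i> - 1) \<le>
        (1 + pd \<i> (e (Suc n))) / (1 - pd \<i> (e (Suc n))) * cmod (?q n - 1)) sequentially"
      using eventually_sequentially_Suc[THEN iffD2, OF e_ne_i]
    proof eventually_elim
      case (elim n)
      then show ?case
        using near_identity(2)[OF G_hol G_pos G_i, of n "Suc n" "e (Suc n)"]
        by (simp add: G_e pd_commute)
    qed
    have "(\<lambda>n. (1 + pd \<i> (e (Suc n))) / (1 - pd \<i> (e (Suc n))) * cmod (?q n - 1)) \<longlonglongrightarrow>
        (1 + a) / (1 - a) * cmod (1 - 1)"
      using a_less by (intro tendsto_intros LIMSEQ_Suc[OF pd_e_lim] cay_e_quotient) auto
    then show "(\<lambda>n. (1 + pd \<i> (e (Suc n))) / (1 - pd \<i> (e (Suc n))) * cmod (?q n - 1)) \<longlonglongrightarrow> 0"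
      by simp
  qed auto
  from tendsto_add[OF this tendsto_const[of 1]] have "(\<lambda>n. deriv (G n (Suc n)) \<i>) \<longlonglongrightarrow> 1"
    by simp
  from tendsto_divide[OF this tendsto_of_real[OF Im_e_lim]]
  have "(\<lambda>n. deriv (G n (Suc n)) \<i> / of_real (Im (e n))) \<longlonglongrightarrow> 1"
    by simp
  moreover have "deriv (G n (Suc n)) \<i> / of_real (Im (e n)) = deriv \<phi> (w (Suc n))" for n
  proof -
    have "(\<phi> has_field_derivative deriv \<phi> (w (Suc n))) (at (T (Suc n) \<i>))"
      unfolding T_i using phi_hol open_uhp by (rule holomorphic_derivI) simp
    moreover have "(T (Suc n) has_field_derivative of_real (y (Suc n))) (at \<i>)"
      unfolding T_def[abs_def] by (auto intro!: derivative_eq_intros)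
    ultimately have "((\<lambda>z. \<phi> (T (Suc n) z)) has_field_derivative
        (deriv \<phi> (w (Suc n)) * of_real (y (Suc n)))) (at \<i>)"
      by (rule DERIV_chain2)
    then have "((\<lambda>z. S n (\<phi> (T (Suc n) z))) has_field_derivative
        (deriv \<phi> (w (Suc n)) * of_real (y (Suc n)) / of_real (y n))) (at \<i>)"
      by (rule S_deriv)
    then have "(G n (Suc n) has_field_derivative
        (deriv \<phi> (w (Suc n)) * of_real (y (Suc n)) / of_real (y n))) (at \<i>)"
      by (simp add: G_def[abs_def])
    then show ?thesis
      by (simp add: DERIV_imp_deriv Im_e)
  qed
  ultimately show "(\<lambda>n. deriv \<phi> (w (Suc n))) \<longlonglongrightarrow> 1"
    by simp
qed

end

section \<open>Properties of the limit map\<close>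

locale backward_orbit_limit = backward_orbit +
  fixes \<psi> :: "complex \<Rightarrow> complex"
  assumes psi: "Im z > 0 \<Longrightarrow> \<psi> z = lim (\<lambda>n. F n z)"
begin

lemma F_uniform_limit:
  assumes "0 < \<nu>" "\<nu> \<le> \<mu>" "1 + B \<le> R"
  shows "uniform_limit {z. \<nu> \<le> Im z \<and> cmod z \<le> R} F \<psi> sequentially"
proof -
  have "uniformly_convergent_on {z. \<nu> \<le> Im z \<and> cmod z \<le> R} F"
    by (intro Cauchy_uniformly_convergent F_uniformly_Cauchy assms)
  then have "uniform_limit {z. \<nu> \<le> Im z \<and> cmod z \<le> R} F (\<lambda>z. lim (\<lambda>n. F n z)) sequentially"
    by (simp add: uniformly_convergent_uniform_limit_iff)
  then show ?thesis
    by (rule uniform_limit_cong[THEN iffD1, rotated 2]) (use assms psi in auto)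
qed

lemma uniform_limit_cball:
  assumes "Im z > 0"
  shows "uniform_limit (cball z (Im z / 2)) F \<psi> sequentially"
proof -
  obtain \<nu> R where "0 < \<nu>" "\<nu> \<le> \<mu>" "1 + B \<le> R"
    and sub: "cball z (Im z / 2) \<subseteq> {z. \<nu> \<le> Im z \<and> cmod z \<le> R}"
    using box_around[OF assms] by blast
  then show ?thesis
    using uniform_limit_on_subset[OF F_uniform_limit sub] by blast
qed

lemma F_lim: "Im z > 0 \<Longrightarrow> (\<lambda>n. F n z) \<longlonglongrightarrow> \<psi> z"
  using tendsto_uniform_limitI[OF uniform_limit_cball] by simp

lemma psi_hol: "\<psi> holomorphic_on uhp"
proof (rule holomorphic_uniform_sequence[OF open_uhp F_hol])
  fix z assume "z \<in> uhp"
  then have z: "Im z > 0"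
    by simp
  have "cball z (Im z / 2) \<subseteq> uhp"
    by (rule box_around[OF z]) auto
  then show "\<exists>d. 0 < d \<and> cball z d \<subseteq> uhp \<and> uniform_limit (cball z d) F \<psi> sequentially"
    using uniform_limit_cball[OF z] z by (intro exI[of _ "Im z / 2"]) auto
qed

text \<open>A limit of self-maps could degenerate to the boundary. The common value
  \<open>F n \<i> = w 0\<close> and Schwarz-Pick keep \<open>Im (F n z)\<close> above a positive
  bound independent of \<open>n\<close>.\<close>

lemma psi_pos:
  assumes z: "Im z > 0"
  shows "Im (\<psi> z) > 0"
proof -
  define k where "k = pd \<i> z"
  have k: "0 \<le> k" "k < 1"
    using z pd_less_1[of \<i> z] by (auto simp: k_def)
  have "(1 - k\<^sup>2) / 4 * y 0 \<le> Im (F n z)" for n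
  proof -
    have "pd (F n \<i>) (F n z) \<le> k"
      unfolding k_def using z by (intro schwarz_pick_uhp F_hol F_pos) auto
    then show ?thesis
      using k z by (intro pd_le_imp(1) F_pos) (auto simp: F_i)
  qed
  then have "(1 - k\<^sup>2) / 4 * y 0 \<le> Im (\<psi> z)"
    by (intro tendsto_lowerbound[OF tendsto_Im[OF F_lim[OF z]]]) auto
  moreover have "k\<^sup>2 < 1"
    using k by (simp add: abs_square_less_1)
  then have "(1 - k\<^sup>2) / 4 * y 0 > 0"
    by simp
  ultimately show ?thesis
    by linarith
qed

text \<open>\<open>F n\<close> takes the value \<open>w k\<close> exactly at
  \<open>S n (w (n + k))\<close>, and these points tend to the given one. Schwarz-Pick supplies the
  equicontinuity needed to pass to the limit.\<close>

lemma psi_zeta: "\<psi> (\<i> + of_nat k * of_real b0) = w k"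
proof -
  define z where "z = \<i> + of_nat k * complex_of_real b0"
  have z: "Im z > 0"
    by (simp add: z_def)
  have "(\<lambda>n. pd (F n z) (w k)) \<longlonglongrightarrow> pd (\<psi> z) (w k)"
    using z by (intro tendsto_pd F_lim tendsto_const psi_pos) auto
  moreover have "(\<lambda>n. pd z (S n (w (n + k)))) \<longlonglongrightarrow> pd z z"
    using z S_w_lim[of k] unfolding z_def[symmetric] by (intro tendsto_pd tendsto_const)
  moreover have "pd (F n z) (w k) \<le> pd z (S n (w (n + k)))" for n
  proof -
    have "pd (F n z) (F n (S n (w (n + k)))) \<le> pd z (S n (w (n + k)))"
      by (intro schwarz_pick_uhp F_hol F_pos z) auto
    then show ?thesis
      by (simp add: F_S_w)
  qed
  ultimately have "pd (\<psi> z) (w k) \<le> pd z z"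
    by (intro LIMSEQ_le) auto
  then have "pd (\<psi> z) (w k) = 0"
    by (intro antisym) auto
  then show ?thesis
    using psi_pos[OF z] by (simp add: pd_eq_0_iff z_def)
qed

lemma deriv_psi_lim: "(\<lambda>n. deriv \<psi> (\<i> + of_nat n * of_real b0) / of_real (y n)) \<longlonglongrightarrow> 1"
proof -
  define c where "c = \<i> + complex_of_real b0"
  have c: "Im c > 0" "c \<noteq> \<i>"
    using b0_pos by (auto simp: c_def)
  \<comment> \<open>The values of \<open>\<psi>\<close> at consecutive points \<open>\<zeta>\<close>
    give \<open>Q n \<i> = \<i>\<close> and \<open>Q n c = e n\<close>, which tends to
    \<open>c\<close>. The translation has derivative 1, and \<open>S n\<close> contributes the
    division by \<open>y n\<close>.\<close>
  define Q where "Q = (\<lambda>n z. S n (\<psi> (z + of_nat n * of_real b0)))"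
  have Q_hol: "Q n holomorphic_on uhp" for n
  proof -
    have "(\<psi> \<circ> (\<lambda>z. z + of_nat n * of_real b0)) holomorphic_on uhp"
      by (intro holomorphic_on_compose_gen[of _ _ \<psi> uhp] psi_hol holomorphic_intros) auto
    then show ?thesis
      unfolding Q_def S_def by (intro holomorphic_intros) (auto simp: o_def)
  qed
  have Q_pos: "Im (Q n z) > 0" if "Im z > 0" for n z
    using psi_pos[of "z + of_nat n * of_real b0"] that by (simp add: Q_def)
  have Q_i: "Q n \<i> = \<i>" for n
    by (simp add: Q_def psi_zeta)
  have Q_c: "Q n c = e n" for n
    using psi_zeta[of "Suc n"] by (simp add: Q_def c_def e_def algebra_simps)
  have "(\<lambda>n. (1 + pd c \<i>) / (1 - pd c \<i>) * cmod (cay (e n) / cay c - 1)) \<longlonglongrightarrow>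
      (1 + pd c \<i>) / (1 - pd c \<i>) * cmod (cay c / cay c - 1)"
    using c by (intro tendsto_intros tendsto_cay e_lim[folded c_def]) (auto simp: cay_eq_0_iff)
  then have lim: "(\<lambda>n. (1 + pd c \<i>) / (1 - pd c \<i>) * cmod (cay (e n) / cay c - 1)) \<longlonglongrightarrow> 0"
    using c by (simp add: cay_eq_0_iff)
  have "(\<lambda>n. deriv (Q n) \<i> - 1) \<longlonglongrightarrow> 0"
    using near_identity(2)[OF Q_hol Q_pos Q_i c] unfolding Q_c
    by (intro tendsto_norm_zero_cancel[OF tendsto_sandwich[OF _ _ tendsto_const lim]]) auto
  from tendsto_add[OF this tendsto_const[of 1]] have "(\<lambda>n. deriv (Q n) \<i>) \<longlonglongrightarrow> 1"
    by simp
  moreover have "deriv (Q n) \<i> = deriv \<psi> (\<i> + of_nat n * of_real b0) / of_real (y n)" for n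
  proof -
    have "(\<psi> has_field_derivative deriv \<psi> (\<i> + of_nat n * of_real b0)) (at (\<i> + of_nat n * of_real b0))"
      using psi_hol open_uhp by (rule holomorphic_derivI) simp
    then have "((\<lambda>z. \<psi> (z + of_nat n * of_real b0)) has_field_derivative
        deriv \<psi> (\<i> + of_nat n * of_real b0)) (at \<i>)"
      by (rule DERIV_shift[THEN iffD1])
    then have "(Q n has_field_derivative (deriv \<psi> (\<i> + of_nat n * of_real b0) / of_real (y n))) (at \<i>)"
      unfolding Q_def by (rule S_deriv)
    then show ?thesis
      by (rule DERIV_imp_deriv)
  qed
  ultimately show ?thesis
    by simp
qed

text \<open>A point $z$ of a sector is compared with $\zeta_n$ for $n \approx \operatorname{Im} z$: if
  $\psi(z)$ were bounded, the Schwarz--Pick inequality would give $x_n^2 = O(n y_n)$, whereas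
  $n y_n = O(x_n)$ and $x_n \to \infty$.\<close>

lemma psi_nt_limit: "nt_limit_at_infinity \<psi> at_infinity"
  unfolding nt_limit_at_infinity_def
proof
  fix \<theta> :: real assume \<theta>: "\<theta> \<in> {0<..<pi / 2}"
  define s where "s = cos \<theta>"
  have s: "s > 0"
    using \<theta> by (auto simp: s_def intro!: cos_gt_zero)
  have sector: "s * cmod z \<le> Im z" if "z \<in> nt_sector \<theta>" for z
  proof -
    have "\<bar>Arg z - pi / 2\<bar> < \<theta>"
      using that by (simp add: nt_sector_def)
    then have "cos \<theta> \<le> cos (\<bar>Arg z - pi / 2\<bar>)"
      using \<theta> by (intro cos_monotone_0_pi_le) auto
    also have "\<dots> = sin (Arg z)"
      by (simp add: cos_diff)
    finally have "s * cmod z \<le> sin (Arg z) * cmod z"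
      unfolding s_def by (intro mult_right_mono) auto
    also have "\<dots> = Im z"
      by (cases "z = 0") (auto simp: sin_Arg)
    finally show ?thesis .
  qed
  show "filterlim \<psi> at_infinity (inf at_infinity (principal (nt_sector \<theta>)))"
    unfolding filterlim_at_infinity[OF order_refl] eventually_inf_principal
  proof (intro allI impI)
    fix r :: real assume r: "r > 0"
    \<comment> \<open>\<open>C * Y\<close> bounds \<open>1 + real n * b0 + cmod z\<close>, using
      \<open>real n \<le> 2 * Y\<close> and \<open>cmod z \<le> Y / s\<close>. Below,
      \<open>x n > 2 * r\<close> gives \<open>cmod (w n - cnj (\<psi> z)) \<ge> x n / 2\<close>, and
      \<open>x n > 4 * A\<close> contradicts the resulting inequality.\<close>
    define C where "C = 1 / s + 2 * b0 + 1"
    define A where "A = r * C\<^sup>2 * (1 + 2 / b0)"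
    have C: "C > 0"
      using b0_pos s by (simp add: C_def add_pos_pos)
    have "eventually (\<lambda>n. x n > max (2 * r) (4 * A)) sequentially"
      using x_lim unfolding filterlim_at_top_dense by blast
    from eventually_conj[OF this index_times_y_le]
    obtain N where N: "\<And>n. n \<ge> N \<Longrightarrow> x n > 2 * r" "\<And>n. n \<ge> N \<Longrightarrow> x n > 4 * A"
      "\<And>n. n \<ge> N \<Longrightarrow> real n * y n \<le> (1 + 2 / b0) * x n"
      by (auto simp: eventually_sequentially)
    have main: "r \<le> cmod (\<psi> z)" if z: "(real N + 1) / s \<le> cmod z" "z \<in> nt_sector \<theta>" for z
    proof (rule ccontr)
      assume "\<not> r \<le> cmod (\<psi> z)"
      then have small: "cmod (\<psi> z) < r"
        by simp
      define Y where "Y = Im z"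
      have zY: "cmod z \<le> Y / s"
        using sector[OF z(2)] s by (simp add: Y_def field_simps)
      then have Y: "real N + 1 \<le> Y"
        using z(1) s by (simp add: field_simps)
      define n where "n = nat \<lceil>Y\<rceil>"
      have n: "Y \<le> real n" "real n \<le> Y + 1" "n \<ge> N"
        using Y by (auto simp: n_def le_nat_iff) linarith+
      define v where "v = \<i> + of_nat n * complex_of_real b0"
      have v: "Im v = 1" "\<psi> v = w n"
        by (simp_all add: v_def psi_zeta)
      have zpos: "Im z > 0"
        using Y by (simp add: Y_def)
      have "cmod v \<le> 1 + real n * b0"
        using norm_triangle_ineq[of \<i> "of_nat n * complex_of_real b0"] b0_pos
        by (simp add: v_def norm_mult)
      moreover have "real n * b0 \<le> (2 * Y) * b0"
        using n Y b0_pos by (intro mult_right_mono) auto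
      ultimately have "cmod (v - cnj z) \<le> C * Y"
        using norm_triangle_ineq4[of v "cnj z"] zY Y by (simp add: C_def algebra_simps)
      then have vz: "(cmod (v - cnj z))\<^sup>2 \<le> (C * Y)\<^sup>2"
        by (intro power_mono) auto
      have "pd (\<psi> z) (w n) \<le> pd z v"
        using schwarz_pick_uhp[OF psi_hol psi_pos zpos, of v] v by simp
      then have "1 - (pd z v)\<^sup>2 \<le> 1 - (pd (\<psi> z) (w n))\<^sup>2"
        by (simp add: power_mono)
      then have "4 * Y / (cmod (v - cnj z))\<^sup>2 \<le> 4 * Im (\<psi> z) * y n / (cmod (w n - cnj (\<psi> z)))\<^sup>2"
        using zpos v psi_pos[OF zpos] by (simp add: one_minus_pd_sq Y_def)
      moreover have "4 * Y / (C * Y)\<^sup>2 \<le> 4 * Y / (cmod (v - cnj z))\<^sup>2"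
        using vz Y diff_cnj_nz[OF zpos, of v] v C by (intro divide_left_mono mult_pos_pos) auto
      moreover have "4 * Im (\<psi> z) * y n / (cmod (w n - cnj (\<psi> z)))\<^sup>2 \<le> 4 * r * y n / (x n / 2)\<^sup>2"
      proof -
        have "Im (\<psi> z) \<le> r"
          using abs_Im_le_cmod[of "\<psi> z"] small by linarith
        moreover have "x n / 2 \<le> cmod (w n - cnj (\<psi> z))"
          using abs_Re_le_cmod[of "w n - cnj (\<psi> z)"] abs_Re_le_cmod[of "\<psi> z"] small N(1)[OF n(3)]
          by simp
        ultimately show ?thesis
          using psi_pos[OF zpos] r N(1)[OF n(3)] less_imp_le[OF y_pos[of n]]
          by (intro frac_le mult_mono power_mono) auto
      qed
      ultimately have "4 * Y / (C * Y)\<^sup>2 \<le> 4 * r * y n / (x n / 2)\<^sup>2"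
        by linarith
      then have "(x n)\<^sup>2 \<le> 4 * (r * C\<^sup>2 * (Y * y n))"
        using C Y N(1)[OF n(3)] r by (simp add: field_simps power2_eq_square)
      also have "\<dots> \<le> 4 * (r * C\<^sup>2 * ((1 + 2 / b0) * x n))"
      proof -
        have "Y * y n \<le> real n * y n"
          using n by (intro mult_right_mono) (auto intro: less_imp_le)
        then have "Y * y n \<le> (1 + 2 / b0) * x n"
          using N(3)[OF n(3)] by (rule order_trans)
        then show ?thesis
          using r by (intro mult_left_mono) auto
      qed
      also have "\<dots> = 4 * A * x n"
        by (simp add: A_def)
      finally have "x n \<le> 4 * A"
        using N(1)[OF n(3)] r by (simp add: power2_eq_square)
      then show False
        using N(2)[OF n(3)] by simp
    qed
    then show "eventually (\<lambda>z. z \<in> nt_sector \<theta> \<longrightarrow> r \<le> cmod (\<psi> z)) at_infinity"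
      unfolding eventually_at_infinity by blast
  qed
qed

end

theorem corollary1p13:
  fixes \<phi> \<psi> :: "complex \<Rightarrow> complex" and w \<zeta> :: "nat \<Rightarrow> complex"
    and \<tau> :: "nat \<Rightarrow> complex \<Rightarrow> complex" and a b0 :: real
  assumes parabolic: "parabolic_self_map \<phi>"
    and backward: "backward_iteration_seq \<phi> w"
    and steps_mono: "incseq (\<lambda>n. pseudo_hyp_dist (w n) (w (Suc n)))"
    and steps_lim: "(\<lambda>n. pseudo_hyp_dist (w n) (w (Suc n))) \<longlonglongrightarrow> a"
    and a_less: "a < 1"
    and w_infinity: "filterlim w at_infinity sequentially"
    and w_Arg: "(\<lambda>n. Arg (w n)) \<longlonglongrightarrow> 0"
    and tau: "\<And>n z. \<tau> n z = of_real (Re (w n)) + of_real (Im (w n)) * z"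
    and psi: "\<And>z. z \<in> upper_half_plane \<Longrightarrow> \<psi> z = lim (\<lambda>n. (\<phi> ^^ n) (\<tau> n z))"
    and b0: "b0 = 2 * a / sqrt (1 - a\<^sup>2)"
    and zeta: "\<And>n. \<zeta> n = \<i> + of_nat n * of_real b0"
  shows "(\<forall>n. \<psi> (\<zeta> n) = w n) \<and>
         (\<lambda>n. deriv \<psi> (\<zeta> n) / of_real (Im (w n))) \<longlonglongrightarrow> 1 \<and>
         nt_limit_at_infinity \<psi> at_infinity \<and>
         (\<lambda>n. deriv \<phi> (w n)) \<longlonglongrightarrow> 1"
proof -
  interpret orbit: backward_orbit \<phi> w a
    by unfold_locales (fact parabolic backward steps_mono steps_lim a_less w_infinity w_Arg)+
  interpret orbit: backward_orbit_limit \<phi> w a \<psi>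
    by unfold_locales (simp add: psi tau orbit.F_def orbit.T_def)
  have "\<zeta> n = \<i> + of_nat n * of_real orbit.b0" for n
    by (simp add: zeta b0 orbit.b0_def)
  then show ?thesis
    using orbit.psi_zeta orbit.deriv_psi_lim orbit.psi_nt_limit orbit.deriv_phi_lim by simp
qed

end
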